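(* Let $\mathcal X$ be a Polish space with metric, Borel $\sigma$-algebra and $\sigma$-finite reference measure $\mathrm dx$; let $\pi,\pi_Y$ be probability measures with densities (also denoted $\pi,\pi_Y$), $w=\pi/\pi_Y$ with $|w|_\infty<\infty$. Fix $\epsilon\in(0,1)$ and a Markov kernel $P$ with stationary distribution $\pi$. Consider the (simplified) Equi-Energy sampler: $X_0=x_0$, $Y_0=y_0$; the auxiliary process $\{Y_n\}$ evolves independently of the main chain, i.e. $\mathbb E(h(Y_{n+1})\mid\mathcal F_n)=\mathbb E(h(Y_{n+1})\mid Y_0,\dots,Y_n)$ for bounded measurable $h$, where $\mathcal F_n=\sigma(X_0,\dots,X_n,Y_0,\dots,Y_n)$; and for nonnegative measurable $h$, $\mathbb E(h(X_{n+1})\mid\mathcal F_n)=P_{\hat\theta_n}h(X_n)$ a.s., where $\hat\theta_n=\frac1n\sum_{i=1}^n\delta_{Y_i}$, \[ P_\theta(x,A)=(1-\epsilon)P(x,A)+\epsilon K_\theta(x,A), \] \[ K_\theta(x,A)=\mathbf 1_A(x)+\int_{\mathcal X}\Big(1\wedge\frac{\pi(z)\pi_Y(x)}{\pi(x)\pi_Y(z)}\Big)\big(\mathbf 1_A(z)-\mathbf 1_A(x)\big)\theta(\mathrm dz). \] Assume: (i) there is a finite constant $C$ such that for every measurable $f$ with $|f|_\infty\le1$ and all $x>0$, \[ \sup_n\mathbb P\Big(\Big|\frac1{\sqrt n}\sum_{j=1}^n(f(Y_j)-\pi_Y(f))\Big|>x\Big)\le C\exp\Big(-\frac{x^2}{C\sigma^2(f)}\Big),\quad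 \sigma^2(f)=\int f^2\,\mathrm d\pi_Y; \] (ii) $w$ is continuous and $\sup_{x\in\mathcal X}\phi(x)/w^2(x)<\infty$, where $\phi(x)=\pi_Y(\{z:w(z)\le w(x)\})$; (iii) $Pf$ is continuous whenever $f:\mathcal X\to\mathbb R$ is continuous. Then there exists a constant $C$ such that for all bounded continuous $f:\mathcal X\to\mathbb R$ and all $n\in\mathbb N$, \[ \big|\mathbb E\big(f(X_n)-\pi(f)\big)\big|\le\frac{C|f|_\infty}{\sqrt n}. \]
   Context: $|f|_\infty=\sup_x|f(x)|$. The kernel $K_{\pi_Y}$ is the independent Metropolis kernel with target $\pi$ and proposal $\pi_Y$. *)

theory Defs
  imports "HOL-Probability.Probability"
begin

definition gen_sa :: "'b measure \<Rightarrow> ('b \<Rightarrow> 'a::topological_space) set \<Rightarrow> 'b measure" where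
  "gen_sa M S = sigma (space M) (\<Union>Z\<in>S. {Z -` A \<inter> space M | A. A \<in> sets borel})"

definition dens :: "'a measure \<Rightarrow> ('a \<Rightarrow> real) \<Rightarrow> 'a measure" where
  "dens mu p = density mu (\<lambda>x. ennreal (p x))"

text \<open>Acceptance probability 1 min (pi(z) piY(x)) / (pi(x) piY(z)); a zero denominator means ratio +infinity, i.e. acceptance 1.\<close>
definition accept :: "('a \<Rightarrow> real) \<Rightarrow> ('a \<Rightarrow> real) \<Rightarrow> 'a \<Rightarrow> 'a \<Rightarrow> real" where
  "accept p pY x z = (if p x * pY z = 0 then 1 else min 1 ((p z * pY x) / (p x * pY z)))"

text \<open>K_theta h (x) for nonnegative h, i.e. the integral of h against the kernel
  K_theta(x,A) = 1_A(x) + int accept(x,z) (1_A(z) - 1_A(x)) theta(dz).\<close>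
definition K_op :: "('a \<Rightarrow> real) \<Rightarrow> ('a \<Rightarrow> real) \<Rightarrow> 'a measure \<Rightarrow> ('a \<Rightarrow> ennreal) \<Rightarrow> 'a \<Rightarrow> ennreal" where
  "K_op p pY \<theta> h x =
     (1 - ennreal (\<integral>z. accept p pY x z \<partial>\<theta>)) * h x + (\<integral>\<^sup>+z. ennreal (accept p pY x z) * h z \<partial>\<theta>)"

definition P_op :: "('a \<Rightarrow> 'a measure) \<Rightarrow> real \<Rightarrow> ('a \<Rightarrow> real) \<Rightarrow> ('a \<Rightarrow> real) \<Rightarrow> 'a measure
     \<Rightarrow> ('a \<Rightarrow> ennreal) \<Rightarrow> 'a \<Rightarrow> ennreal" where
  "P_op P \<epsilon> p pY \<theta> h x = ennreal (1 - \<epsilon>) * (\<integral>\<^sup>+y. h y \<partial>(P x)) + ennreal \<epsilon> * K_op p pY \<theta> h x"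

text \<open>Empirical measure (1/n) sum_{i=1}^n delta_{y_i} (for n \<ge> 1).\<close>
definition emp :: "(nat \<Rightarrow> 'a) \<Rightarrow> nat \<Rightarrow> 'a measure" where
  "emp ys n = measure_pmf (pmf_of_multiset (mset (map ys [1..<Suc n])))"

end

theory Submission
  imports Defs
begin

text \<open>
Write \<open>b(x,z) = min 1 (w z / w x)\<close> for the acceptance probability. The limiting kernel
\<open>P\<^sub>*\<close> built from \<open>\<pi>\<^sub>Y\<close> preserves \<open>\<pi>\<close> and satisfies
\<open>P\<^sub>*(x, A) \<ge> (\<epsilon> / B) \<pi>(A)\<close> with \<open>B\<close> a bound for \<open>w\<close>, so each step contracts the error by
\<open>1 - \<epsilon> / B\<close>. Replacing \<open>P\<^sub>*\<close> by the actual kernel at time \<open>n\<close> costs at most twice the supremum over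
\<open>x\<close> of \<open>|(\<theta>\<^sub>n - \<pi>\<^sub>Y)(b(x,\<cdot>) g)|\<close>. No chaining is needed to bound it: for \<open>0 < w x\<close>,
\<open>b(x,z) = w z / B + \<integral> (w z / s\<^sup>2) 1(w z \<le> s) ds\<close> over \<open>w x \<le> s \<le> B\<close>, so the supremum is
dominated by an integral over \<open>s\<close> of deviations of fixed functions. The variance of the integrand is at
most \<open>\<pi>\<^sub>Y(w \<le> s) / s\<^sup>2\<close>, which assumption (ii) bounds uniformly in \<open>s\<close>, and the concentration
assumption (i) gives \<open>O(1 / sqrt n)\<close> in mean. The resulting recursion
\<open>e (n + 1) \<le> (1 - \<epsilon> / B) e n + c / sqrt n\<close> yields the rate.
\<close>

subsection \<open>Empirical measures and sub-Gaussian means\<close>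

text \<open>The empirical measure is the law of \<open>ys\<close> at a uniformly chosen index, so
  integrals against it become finite averages. \<open>n \<ge> 1\<close> keeps the index set
  nonempty.\<close>

lemma emp_eq_map_pmf:
  assumes "n \<ge> 1"
  shows "emp ys n = measure_pmf (map_pmf ys (pmf_of_set {1..n}))"
proof -
  have "mset [1..<Suc n] = mset_set {1..n}"
    by (metis mset_upt atLeastLessThanSuc_atLeastAtMost)
  then have "mset (map ys [1..<Suc n]) = image_mset ys (mset_set {1..n})"
    by (metis mset_map)
  with assms show ?thesis
    unfolding emp_def by (subst map_pmf_of_set) auto
qed

lemma integral_emp:
  fixes f :: "'a \<Rightarrow> real"
  assumes "n \<ge> 1"
  shows "(\<integral>z. f z \<partial>emp ys n) = (\<Sum>j=1..n. f (ys j)) / n"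
  using assms by (simp add: emp_eq_map_pmf integral_pmf_of_set)

lemma nn_integral_emp:
  assumes "n \<ge> 1"
  shows "(\<integral>\<^sup>+z. f z \<partial>emp ys n) = (\<Sum>j=1..n. f (ys j)) / n"
  using assms by (simp add: emp_eq_map_pmf nn_integral_pmf_of_set)

lemma prob_space_emp: "prob_space (emp ys n)"
  unfolding emp_def by (rule prob_space_measure_pmf)

text \<open>Up to the factor \<open>sqrt (pi * a)\<close> the integrand is the centred normal
  density of variance \<open>a / 2\<close>, which has total mass 1.\<close>

lemma nn_integral_exp_square:
  fixes a :: real
  assumes "a > 0"
  shows "(\<integral>\<^sup>+x. ennreal (exp (- (x\<^sup>2 / a))) \<partial>lborel) = ennreal (sqrt (pi * a))"
proof -
  have "exp (- (x\<^sup>2 / a)) = sqrt (pi * a) * normal_density 0 (sqrt (a / 2)) x" for x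
    using assms by (simp add: normal_density_def field_simps)
  then have "(\<integral>\<^sup>+x. ennreal (exp (- (x\<^sup>2 / a))) \<partial>lborel)
      = (\<integral>\<^sup>+x. ennreal (sqrt (pi * a)) * ennreal (normal_density 0 (sqrt (a / 2)) x) \<partial>lborel)"
    using assms by (simp add: ennreal_mult' normal_density_nonneg)
  also have "\<dots> = ennreal (sqrt (pi * a))
      * emeasure (density lborel (normal_density 0 (sqrt (a / 2)))) UNIV"
    by (simp add: nn_integral_cmult emeasure_density)
  also have "emeasure (density lborel (normal_density 0 (sqrt (a / 2)))) UNIV = 1"
    using prob_space.emeasure_space_1[OF prob_space_normal_density[of "sqrt (a/2)" 0]] assms by simp
  finally show ?thesis by simp
qed

text \<open>\<open>\<bar>Z \<omega>\<bar>\<close> is the length of the interval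
  \<open>{0<..<\<bar>Z \<omega>\<bar>}\<close>; Tonelli exchanges length and probability.\<close>

lemma (in prob_space) nn_integral_abs_layer_cake:
  fixes Z :: "'a \<Rightarrow> real"
  assumes [measurable]: "Z \<in> borel_measurable M"
  shows "(\<integral>\<^sup>+\<omega>. ennreal \<bar>Z \<omega>\<bar> \<partial>M)
    = (\<integral>\<^sup>+x. indicator {0<..} x * emeasure M {\<omega>\<in>space M. \<bar>Z \<omega>\<bar> > x} \<partial>lborel)"
proof -
  interpret P: pair_sigma_finite M lborel ..
  have "(\<integral>\<^sup>+\<omega>. ennreal \<bar>Z \<omega>\<bar> \<partial>M)
      = (\<integral>\<^sup>+\<omega>. (\<integral>\<^sup>+x. indicator {0<..} x * indicator {\<omega>\<in>space M. \<bar>Z \<omega>\<bar> > x} \<omega> \<partial>lborel) \<partial>M)"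
  proof (rule nn_integral_cong)
    fix \<omega> assume "\<omega> \<in> space M"
    then have "indicator {0<..} x * indicator {\<omega>\<in>space M. \<bar>Z \<omega>\<bar> > x} \<omega>
        = (indicator {0<..<\<bar>Z \<omega>\<bar>} x :: ennreal)" for x
      by (auto split: split_indicator)
    then show "ennreal \<bar>Z \<omega>\<bar>
        = (\<integral>\<^sup>+x. indicator {0<..} x * indicator {\<omega>\<in>space M. \<bar>Z \<omega>\<bar> > x} \<omega> \<partial>lborel)"
      by simp
  qed
  also have "\<dots> = (\<integral>\<^sup>+x. (\<integral>\<^sup>+\<omega>. indicator {0<..} x
      * indicator {\<omega>\<in>space M. \<bar>Z \<omega>\<bar> > x} \<omega> \<partial>M) \<partial>lborel)"
    unfolding indicator_def by (rule P.Fubini'[symmetric]) measurable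
  finally show ?thesis by (simp add: nn_integral_cmult)
qed

text \<open>Integrating the tail over the whole line instead of the half-line costs a constant
  factor and yields a Gaussian integral of variance proportional to \<open>s\<close>, hence
  \<open>sqrt s\<close>. For \<open>s = 0\<close> the tail has to vanish outright, since
  \<open>x\<^sup>2 / 0 = 0\<close> would leave no decay.\<close>

lemma (in prob_space) nn_integral_abs_le_subgaussian:
  fixes Z :: "'a \<Rightarrow> real"
  assumes [measurable]: "Z \<in> borel_measurable M" and "C > 0" "s \<ge> 0"
    and tail: "\<And>x. x > 0 \<Longrightarrow> prob {\<omega>\<in>space M. \<bar>Z \<omega>\<bar> > x}
        \<le> (if s = 0 then 0 else C * exp (- (x\<^sup>2 / (C * s))))"
  shows "(\<integral>\<^sup>+\<omega>. ennreal \<bar>Z \<omega>\<bar> \<partial>M) \<le> ennreal (C * sqrt (pi * C) * sqrt s)"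
proof -
  have "(\<integral>\<^sup>+\<omega>. ennreal \<bar>Z \<omega>\<bar> \<partial>M)
      \<le> (\<integral>\<^sup>+x. ennreal (if s = 0 then 0 else C * exp (- (x\<^sup>2 / (C * s)))) \<partial>lborel)"
    unfolding nn_integral_abs_layer_cake[OF assms(1)]
  proof (rule nn_integral_mono)
    fix x :: real
    show "indicator {0<..} x * emeasure M {\<omega>\<in>space M. \<bar>Z \<omega>\<bar> > x}
        \<le> ennreal (if s = 0 then 0 else C * exp (- (x\<^sup>2 / (C * s))))"
      using tail[of x] by (auto simp: emeasure_eq_measure measure_le_0_iff split: split_indicator intro: ennreal_leI)
  qed
  also have "\<dots> \<le> ennreal (C * sqrt (pi * C) * sqrt s)"
  proof (cases "s = 0")
    case False
    with assms have "C * s > 0" by simp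
    have "(\<integral>\<^sup>+x. ennreal (C * exp (- (x\<^sup>2 / (C * s)))) \<partial>lborel)
        = ennreal C * (\<integral>\<^sup>+x. ennreal (exp (- (x\<^sup>2 / (C * s)))) \<partial>lborel)"
      using \<open>C > 0\<close> by (subst nn_integral_cmult[symmetric]) (auto simp: ennreal_mult')
    also have "\<dots> = ennreal (C * sqrt (pi * C) * sqrt s)"
      unfolding nn_integral_exp_square[OF \<open>C * s > 0\<close>]
      using assms by (subst ennreal_mult'[symmetric]) (auto simp: real_sqrt_mult mult_ac)
    finally show ?thesis using False by simp
  qed simp
  finally show ?thesis .
qed

subsection \<open>The Metropolis acceptance probability as an integral over thresholds\<close>

text \<open>\<open>metro u v\<close> is the acceptance probability of a move from weight \<open>u\<close> to weight \<open>v\<close>, and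
  \<open>- metro_rate s v\<close> is the derivative of \<open>metro s v\<close> in \<open>s\<close>.\<close>

definition metro :: "real \<Rightarrow> real \<Rightarrow> real" where
  "metro u v = (if u = 0 then 1 else min 1 (v / u))"

definition metro_rate :: "real \<Rightarrow> real \<Rightarrow> real" where
  "metro_rate s v = (if v \<le> s then v / s\<^sup>2 else 0)"

lemma measurable_metro [measurable]:
  assumes [measurable]: "f \<in> borel_measurable N" "g \<in> borel_measurable N"
  shows "(\<lambda>x. metro (f x) (g x)) \<in> borel_measurable N"
  unfolding metro_def by measurable

lemma measurable_metro_rate [measurable]:
  assumes [measurable]: "f \<in> borel_measurable N" "g \<in> borel_measurable N"
  shows "(\<lambda>x. metro_rate (f x) (g x)) \<in> borel_measurable N"
  unfolding metro_rate_def by measurable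

lemma metro_bounds: "0 \<le> u \<Longrightarrow> 0 \<le> v \<Longrightarrow> 0 \<le> metro u v \<and> metro u v \<le> 1"
  by (auto simp: metro_def)

lemma metro_rate_nonneg: "0 \<le> v \<Longrightarrow> 0 \<le> metro_rate s v"
  by (auto simp: metro_rate_def)

lemma metro_rate_le:
  assumes "0 < s" "0 \<le> v"
  shows "s * metro_rate s v \<le> 1"
  using assms by (auto simp: metro_rate_def power2_eq_square divide_simps)

text \<open>The rate vanishes for \<open>s < v\<close>, and on \<open>{max u v..B}\<close> it has
  the antiderivative \<open>- v / s\<close>. The lower endpoint contributes
  \<open>v / max u v\<close>, which is \<open>metro u v\<close>.\<close>

lemma metro_eq_integral:
  assumes "0 < u" "u \<le> B" "0 \<le> v" "v \<le> B"
  shows "(\<integral>s. indicator {u..B} s * metro_rate s v \<partial>lborel) = metro u v - v / B"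
proof -
  have "(\<integral>s. (v / s\<^sup>2) * indicator {max u v..B} s \<partial>lborel) = (- v / B) - (- v / max u v)"
  proof (rule integral_FTC_Icc_real)
    fix x assume "max u v \<le> x" "x \<le> B"
    with assms have "x > 0" by auto
    then show "((\<lambda>s. - v / s) has_real_derivative v / x\<^sup>2) (at x)"
      by (auto intro!: derivative_eq_intros simp: power2_eq_square)
    show "isCont (\<lambda>s. v / s\<^sup>2) x" using \<open>x > 0\<close> by (intro continuous_intros) auto
  qed (use assms in auto)
  moreover have "(v / s\<^sup>2) * indicator {max u v..B} s = indicator {u..B} s * metro_rate s v" for s
    by (auto simp: metro_rate_def split: split_indicator)
  ultimately have "(\<integral>s. indicator {u..B} s * metro_rate s v \<partial>lborel) = v / max u v - v / B"
    by simp
  moreover have "v / max u v = metro u v"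
    using assms by (auto simp: metro_def min_def max_def)
  ultimately show ?thesis by simp
qed

text \<open>Fubini applied to \<open>metro_eq_integral\<close>. Stated for any finite measure, it
  serves both \<beta> and the empirical measure, whose splittings are later subtracted.\<close>

lemma (in finite_measure) integral_metro:
  fixes w g :: "'a \<Rightarrow> real"
  assumes [measurable]: "w \<in> borel_measurable M" "g \<in> borel_measurable M"
    and w: "\<And>z. 0 \<le> w z" "\<And>z. w z \<le> B" and g: "\<And>z. \<bar>g z\<bar> \<le> 1" and u: "0 < u" "u \<le> B"
  shows "(\<integral>z. metro u (w z) * g z \<partial>M) = (\<integral>z. w z / B * g z \<partial>M)
      + (\<integral>s. indicator {u..B} s * (\<integral>z. metro_rate s (w z) * g z \<partial>M) \<partial>lborel)" (is ?eq)
    and "integrable lborel (\<lambda>s. indicator {u..B} s * (\<integral>z. metro_rate s (w z) * g z \<partial>M))" (is ?int)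
proof -
  interpret P: pair_sigma_finite M lborel ..
  let ?f = "\<lambda>z s. indicator {u..B} s * metro_rate s (w z) * g z"
  have B: "0 < B" using u by simp
  \<comment> \<open>For \<open>u \<le> s \<le> B\<close> the integrand is at most
    \<open>1 / u\<close>, and the rectangle has finite measure, so positivity of \<open>u\<close>
    gives integrability.\<close>
  have I: "integrable (M \<Otimes>\<^sub>M lborel) (case_prod ?f)"
  proof (rule Bochner_Integration.integrable_bound)
    have "emeasure (M \<Otimes>\<^sub>M lborel) (space M \<times> {u..B}) = emeasure M (space M) * emeasure lborel {u..B}"
      by (intro lborel.emeasure_pair_measure_Times) auto
    also have "\<dots> < \<infinity>"
      using u by (simp add: emeasure_eq_measure ennreal_mult_less_top)
    finally have "emeasure (M \<Otimes>\<^sub>M lborel) (space M \<times> {u..B}) < \<infinity>" .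
    then show "integrable (M \<Otimes>\<^sub>M lborel) (\<lambda>p. indicator (space M \<times> {u..B}) p * (1 / u))"
      by (intro integrable_mult_left integrable_real_indicator) auto
    show "case_prod ?f \<in> borel_measurable (M \<Otimes>\<^sub>M lborel)" by measurable
    show "AE p in M \<Otimes>\<^sub>M lborel. norm (case_prod ?f p) \<le> norm (indicator (space M \<times> {u..B}) p * (1 / u))"
    proof (rule AE_I2)
      fix p :: "'a \<times> real" assume "p \<in> space (M \<Otimes>\<^sub>M lborel)"
      obtain z s where p: "p = (z, s)" by fastforce
      have "\<bar>metro_rate s (w z) * g z\<bar> \<le> 1 / u" if "u \<le> s"
      proof -
        have "u * metro_rate s (w z) \<le> s * metro_rate s (w z)"
          using that w by (intro mult_right_mono metro_rate_nonneg) auto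
        also have "\<dots> \<le> 1" using metro_rate_le that u w by simp
        finally have "metro_rate s (w z) \<le> 1 / u" using u by (simp add: field_simps)
        then show ?thesis
          using mult_mono[OF _ g[of z], of "metro_rate s (w z)" "1 / u"] u metro_rate_nonneg[OF w(1)[of z], of s]
          by (simp add: abs_mult)
      qed
      then show "norm (case_prod ?f p) \<le> norm (indicator (space M \<times> {u..B}) p * (1 / u))"
        using \<open>p \<in> _\<close> u by (auto simp: p space_pair_measure abs_mult split: split_indicator)
    qed
  qed
  have eq: "(\<integral>z. ?f z s \<partial>M) = indicator {u..B} s * (\<integral>z. metro_rate s (w z) * g z \<partial>M)" for s
    by (simp add: mult.assoc)
  show ?int using P.integrable_snd[OF I] by (simp add: eq)
  have "(\<integral>s. indicator {u..B} s * (\<integral>z. metro_rate s (w z) * g z \<partial>M) \<partial>lborel)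
      = (\<integral>z. (\<integral>s. ?f z s \<partial>lborel) \<partial>M)"
    using P.Fubini_integral[OF I] by (simp add: eq)
  also have "\<dots> = (\<integral>z. (metro u (w z) - w z / B) * g z \<partial>M)"
    using metro_eq_integral[OF u w] by simp
  also have "\<dots> = (\<integral>z. metro u (w z) * g z \<partial>M) - (\<integral>z. w z / B * g z \<partial>M)"
  proof -
    have "integrable M (\<lambda>z. metro u (w z) * g z)" "integrable M (\<lambda>z. w z / B * g z)"
      using w g u B metro_bounds[of u]
      by (auto intro!: integrable_const_bound[where B=1] AE_I2 mult_le_one simp: abs_mult simp del: times_divide_eq_left)
    then show ?thesis by (simp add: left_diff_distrib Bochner_Integration.integral_diff)
  qed
  finally show ?eq by simp
qed

text \<open>The hypothesis speaks only of levels attained by \<open>w\<close>, the conclusion of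
  every \<open>s\<close>. With \<open>v\<close> the supremum of the values up to \<open>s\<close>,
  the set is the sublevel set at \<open>v\<close> if \<open>v\<close> is attained; otherwise it is
  the increasing union of the sets below \<open>v - 1 / Suc n\<close>, each inside the sublevel set
  of an attained value.\<close>

lemma (in finite_measure) measure_sublevel_le:
  fixes w :: "'a \<Rightarrow> real"
  assumes [measurable]: "w \<in> borel_measurable M" and w: "\<And>x. 0 \<le> w x" and "0 \<le> K"
    and K: "\<And>x. measure M {z \<in> space M. w z \<le> w x} \<le> K * (w x)\<^sup>2"
  shows "measure M {z \<in> space M. w z \<le> s} \<le> K * s\<^sup>2"
proof (cases "\<exists>x. w x \<le> s")
  case False
  then have "{z \<in> space M. w z \<le> s} = {}" by auto
  then have "measure M {z \<in> space M. w z \<le> s} = 0" by (simp only: measure_empty)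
  with \<open>0 \<le> K\<close> show ?thesis by simp
next
  case True
  define v where "v = (SUP x\<in>{x. w x \<le> s}. w x)"
  have bdd: "bdd_above (w ` {x. w x \<le> s})" by auto
  have le: "K * (w x)\<^sup>2 \<le> K * s\<^sup>2" if "w x \<le> s" for x
    using that w \<open>0 \<le> K\<close> by (intro mult_left_mono power_mono)
  show ?thesis
  proof (cases "\<exists>x. w x \<le> s \<and> w x = v")
    case True
    then obtain x where x: "w x \<le> s" "w x = v" by auto
    have "{z \<in> space M. w z \<le> s} \<subseteq> {z \<in> space M. w z \<le> w x}"
      using bdd by (auto simp: x v_def intro: cSUP_upper)
    then have "measure M {z \<in> space M. w z \<le> s} \<le> measure M {z \<in> space M. w z \<le> w x}"
      by (intro finite_measure_mono) auto
    with K[of x] le[OF x(1)] show ?thesis by simp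
  next
    case False
    let ?A = "\<lambda>n. {z \<in> space M. w z \<le> s \<and> w z \<le> v - 1 / real (Suc n)}"
    have lt: "w x < v" if "w x \<le> s" for x
    proof -
      have "w x \<le> v" using bdd that by (auto simp: v_def intro: cSUP_upper)
      with False that show ?thesis by (meson order_le_less)
    qed
    have "incseq ?A"
    proof (rule incseq_SucI)
      fix n
      have "1 / real (Suc (Suc n)) \<le> 1 / real (Suc n)" by (simp add: field_simps)
      then show "?A n \<subseteq> ?A (Suc n)" by auto
    qed
    moreover have "(\<Union>n. ?A n) = {z \<in> space M. w z \<le> s}"
    proof -
      have "\<exists>n. w z \<le> v - 1 / real (Suc n)" if "w z \<le> s" for z
        using reals_Archimedean[of "v - w z"] lt[OF that] by (auto simp: inverse_eq_divide intro: less_imp_le exI)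
          (metis diff_less_eq less_eq_real_def add.commute less_diff_eq)
      then show ?thesis by auto
    qed
    ultimately have "(\<lambda>n. measure M (?A n)) \<longlonglongrightarrow> measure M {z \<in> space M. w z \<le> s}"
      using finite_Lim_measure_incseq[of ?A] by (auto simp: image_subset_iff)
    moreover have "measure M (?A n) \<le> K * s\<^sup>2" for n
    proof -
      have "v - 1 / real (Suc n) < v" by simp
      then obtain x where x: "w x \<le> s" "v - 1 / real (Suc n) < w x"
        using True unfolding v_def by (subst (asm) less_cSUP_iff) (auto intro: bdd)
      have "measure M (?A n) \<le> measure M {z \<in> space M. w z \<le> w x}"
        using x by (intro finite_measure_mono) auto
      with K[of x] le[OF x(1)] show ?thesis by simp
    qed
    ultimately show ?thesis by (intro LIMSEQ_le_const2) auto
  qed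
qed

subsection \<open>Uniform deviation of the empirical measure\<close>

definition emp_dev :: "'a measure \<Rightarrow> (nat \<Rightarrow> 'a) \<Rightarrow> nat \<Rightarrow> ('a \<Rightarrow> real) \<Rightarrow> real" where
  "emp_dev \<beta> y n g = (\<integral>z. g z \<partial>emp y n) - (\<integral>z. g z \<partial>\<beta>)"

lemma emp_dev_cmult: "emp_dev \<beta> y n (\<lambda>z. c * g z) = c * emp_dev \<beta> y n g"
  by (simp add: emp_dev_def right_diff_distrib)

lemma sets_emp [simp]: "sets (emp ys n) = UNIV"
  by (simp add: emp_def)

lemma measurable_emp [simp]: "f \<in> borel_measurable (emp ys n)"
  by (simp add: emp_def)

text \<open>Splitting the acceptance probability under both measures and subtracting leaves an
  integral over \<open>{u..B}\<close>, which is enlarged to \<open>{0<..B}\<close>. The right-hand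
  side is then free of \<open>u\<close> and bounds the supremum over \<open>u\<close> path by path.
  The term with \<open>g\<close> alone covers \<open>u = 0\<close>, where every move is
  accepted.\<close>

lemma emp_dev_metro_le:
  fixes w g :: "'a::topological_space \<Rightarrow> real"
  assumes "prob_space \<beta>" "sets \<beta> = sets borel"
    and [measurable]: "w \<in> borel_measurable borel" "g \<in> borel_measurable borel"
    and w: "\<And>z. 0 \<le> w z" "\<And>z. w z \<le> B" and g: "\<And>z. \<bar>g z\<bar> \<le> 1" and u: "0 \<le> u" "u \<le> B"
  shows "ennreal \<bar>emp_dev \<beta> y n (\<lambda>z. metro u (w z) * g z)\<bar>
    \<le> ennreal \<bar>emp_dev \<beta> y n g\<bar> + ennreal \<bar>emp_dev \<beta> y n (\<lambda>z. w z / B * g z)\<bar>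
      + (\<integral>\<^sup>+s. indicator {0<..B} s * ennreal \<bar>emp_dev \<beta> y n (\<lambda>z. metro_rate s (w z) * g z)\<bar> \<partial>lborel)"
proof (cases "u = 0")
  case True
  then show ?thesis by (simp add: metro_def add.assoc)
next
  case False
  with u have u: "0 < u" "u \<le> B" by auto
  interpret \<beta>: prob_space \<beta> by fact
  interpret \<theta>: prob_space "emp y n" by (rule prob_space_emp)
  have [measurable_cong]: "sets \<beta> = sets borel" by fact
  let ?F = "\<lambda>s. emp_dev \<beta> y n (\<lambda>z. metro_rate s (w z) * g z)"
  note b = \<beta>.integral_metro[of w g, OF _ _ w g u]
  note t = \<theta>.integral_metro[of w g, OF _ _ w g u]
  have split: "indicator {u..B} s * ?F s
      = indicator {u..B} s * (\<integral>z. metro_rate s (w z) * g z \<partial>emp y n)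
        - indicator {u..B} s * (\<integral>z. metro_rate s (w z) * g z \<partial>\<beta>)" for s
    by (simp add: emp_dev_def right_diff_distrib)
  have I: "integrable lborel (\<lambda>s. indicator {u..B} s * ?F s)"
    unfolding split by (intro Bochner_Integration.integrable_diff b t) auto
  have "emp_dev \<beta> y n (\<lambda>z. metro u (w z) * g z)
      = emp_dev \<beta> y n (\<lambda>z. w z / B * g z) + (\<integral>s. indicator {u..B} s * ?F s \<partial>lborel)"
    unfolding split
    using b t by (subst Bochner_Integration.integral_diff) (auto simp: emp_dev_def)
  then have "\<bar>emp_dev \<beta> y n (\<lambda>z. metro u (w z) * g z)\<bar>
      \<le> \<bar>emp_dev \<beta> y n (\<lambda>z. w z / B * g z)\<bar> + \<bar>\<integral>s. indicator {u..B} s * ?F s \<partial>lborel\<bar>"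
    by linarith
  then have 1: "ennreal \<bar>emp_dev \<beta> y n (\<lambda>z. metro u (w z) * g z)\<bar>
      \<le> ennreal \<bar>emp_dev \<beta> y n (\<lambda>z. w z / B * g z)\<bar>
        + ennreal \<bar>\<integral>s. indicator {u..B} s * ?F s \<partial>lborel\<bar>"
    by (auto dest: ennreal_leI)
  have "ennreal \<bar>\<integral>s. indicator {u..B} s * ?F s \<partial>lborel\<bar>
      \<le> (\<integral>\<^sup>+s. ennreal \<bar>indicator {u..B} s * ?F s\<bar> \<partial>lborel)"
    using integral_norm_bound_ennreal[OF I] by simp
  also have "\<dots> \<le> (\<integral>\<^sup>+s. indicator {0<..B} s * ennreal \<bar>?F s\<bar> \<partial>lborel)"
    using u by (intro nn_integral_mono) (auto split: split_indicator)
  finally have "ennreal \<bar>emp_dev \<beta> y n (\<lambda>z. metro u (w z) * g z)\<bar>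
      \<le> ennreal \<bar>emp_dev \<beta> y n (\<lambda>z. w z / B * g z)\<bar>
        + (\<integral>\<^sup>+s. indicator {0<..B} s * ennreal \<bar>?F s\<bar> \<partial>lborel)"
    by (rule order_trans[OF 1 add_left_mono])
  also have "\<dots> \<le> ennreal \<bar>emp_dev \<beta> y n g\<bar> + \<dots>"
    by simp
  finally show ?thesis by (simp only: add.assoc)
qed

text \<open>\<open>tail\<close> is the concentration assumption (i) in terms of
  \<open>emp_dev\<close>. \<open>sublevel\<close> is the bound on \<open>\<phi> / w\<^sup>2\<close>
  with the denominator cleared; at a point with \<open>w x = 0\<close> it forces the set where
  \<open>w\<close> vanishes to be null.\<close>

locale empirical_metropolis = prob_space M + \<beta>: prob_space \<beta>
  for M :: "'b measure" and \<beta> :: "'a::topological_space measure" +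
  fixes Y :: "nat \<Rightarrow> 'b \<Rightarrow> 'a" and w :: "'a \<Rightarrow> real" and B C K :: real
  assumes sets_\<beta> [measurable_cong]: "sets \<beta> = sets borel"
    and Y_measurable [measurable]: "\<And>n. Y n \<in> M \<rightarrow>\<^sub>M borel"
    and w_measurable [measurable]: "w \<in> borel_measurable borel"
    and w_nonneg: "\<And>z. 0 \<le> w z" and w_le: "\<And>z. w z \<le> B" and B_ge_1: "1 \<le> B"
    and C_pos: "0 < C" and K_nonneg: "0 \<le> K"
    and tail: "\<And>f x n. f \<in> borel_measurable borel \<Longrightarrow> (\<And>z. \<bar>f z\<bar> \<le> 1) \<Longrightarrow> x > 0 \<Longrightarrow> n \<ge> 1 \<Longrightarrow>
      prob {\<omega>\<in>space M. \<bar>sqrt (real n) * emp_dev \<beta> (\<lambda>i. Y i \<omega>) n f\<bar> > x}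
        \<le> (if (\<integral>z. (f z)\<^sup>2 \<partial>\<beta>) = 0 then 0 else C * exp (- (x\<^sup>2 / (C * (\<integral>z. (f z)\<^sup>2 \<partial>\<beta>)))))"
    and sublevel: "\<And>x. \<beta>.prob {z. w z \<le> w x} \<le> K * (w x)\<^sup>2"
begin

section \<open>Mean deviation of the empirical measure\<close>

lemma space_\<beta>: "space \<beta> = UNIV"
  using sets_eq_imp_space_eq[OF sets_\<beta>] by simp

text \<open>A variable with the tail in \<open>tail\<close> and variance proxy \<open>s\<close> has
  absolute mean at most \<open>G * sqrt s\<close>.\<close>

definition G :: real where "G = C * sqrt (pi * C)"

lemma G_nonneg: "0 \<le> G"
  using C_pos by (simp add: G_def)

text \<open>\<open>tail\<close> controls the deviation multiplied by \<open>sqrt n\<close>; dividing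
  the resulting mean by \<open>sqrt n\<close> produces the rate.\<close>

lemma nn_integral_emp_dev_le:
  assumes [measurable]: "f \<in> borel_measurable borel" and f: "\<And>z. \<bar>f z\<bar> \<le> 1" and n: "n \<ge> 1"
  shows "(\<integral>\<^sup>+\<omega>. ennreal \<bar>emp_dev \<beta> (\<lambda>i. Y i \<omega>) n f\<bar> \<partial>M)
    \<le> ennreal (G * sqrt (\<integral>z. (f z)\<^sup>2 \<partial>\<beta>) / sqrt n)"
proof -
  let ?Z = "\<lambda>\<omega>. emp_dev \<beta> (\<lambda>i. Y i \<omega>) n f"
  have [measurable]: "?Z \<in> borel_measurable M"
    unfolding emp_dev_def integral_emp[OF n] by measurable
  have "(\<integral>\<^sup>+\<omega>. ennreal \<bar>sqrt n * ?Z \<omega>\<bar> \<partial>M) \<le> ennreal (G * sqrt (\<integral>z. (f z)\<^sup>2 \<partial>\<beta>))"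
    unfolding G_def using tail[OF assms(1) f _ n] C_pos
    by (intro nn_integral_abs_le_subgaussian) auto
  moreover have "ennreal \<bar>?Z \<omega>\<bar> = ennreal (1 / sqrt n) * ennreal \<bar>sqrt n * ?Z \<omega>\<bar>" for \<omega>
    using n by (subst ennreal_mult[symmetric]) (auto simp: abs_mult)
  ultimately have "(\<integral>\<^sup>+\<omega>. ennreal \<bar>?Z \<omega>\<bar> \<partial>M)
      \<le> ennreal (1 / sqrt n) * ennreal (G * sqrt (\<integral>z. (f z)\<^sup>2 \<partial>\<beta>))"
    by (simp add: nn_integral_cmult mult_left_mono)
  also have "\<dots> = ennreal (G * sqrt (\<integral>z. (f z)\<^sup>2 \<partial>\<beta>) / sqrt n)"
    using G_nonneg by (subst ennreal_mult[symmetric]) auto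
  finally show ?thesis .
qed

lemma nn_integral_emp_dev_le_unit:
  assumes [measurable]: "f \<in> borel_measurable borel" and f: "\<And>z. \<bar>f z\<bar> \<le> 1" and n: "n \<ge> 1"
  shows "(\<integral>\<^sup>+\<omega>. ennreal \<bar>emp_dev \<beta> (\<lambda>i. Y i \<omega>) n f\<bar> \<partial>M) \<le> ennreal (G / sqrt n)"
proof -
  have "(\<integral>z. (f z)\<^sup>2 \<partial>\<beta>) \<le> 1"
    using f by (intro \<beta>.integral_le_const \<beta>.integrable_const_bound[where B=1] AE_I2)
      (auto simp: abs_square_le_1 power_abs)
  then have "G * sqrt (\<integral>z. (f z)\<^sup>2 \<partial>\<beta>) / sqrt n \<le> G / sqrt n"
    using G_nonneg by (intro divide_right_mono mult_left_le) auto
  then show ?thesis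
    using nn_integral_emp_dev_le[OF assms] order_trans ennreal_leI by blast
qed

text \<open>The quadratic bound on sublevel sets of \<^term>\<open>w\<close> makes this estimate uniform in \<^term>\<open>s\<close>.\<close>

lemma nn_integral_emp_dev_rate_le:
  assumes [measurable]: "g \<in> borel_measurable borel" and g: "\<And>z. \<bar>g z\<bar> \<le> 1"
    and n: "n \<ge> 1" and s: "s > 0"
  shows "(\<integral>\<^sup>+\<omega>. ennreal \<bar>emp_dev \<beta> (\<lambda>i. Y i \<omega>) n (\<lambda>z. metro_rate s (w z) * g z)\<bar> \<partial>M)
    \<le> ennreal (G * sqrt K / sqrt n)"
proof -
  \<comment> \<open>Multiplying by \<open>s\<close> brings the integrand into [-1, 1], the range
    that \<open>tail\<close> demands.\<close>
  let ?h = "\<lambda>z. s * (metro_rate s (w z) * g z)"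
  have h: "\<bar>?h z\<bar> \<le> indicator {z. w z \<le> s} z" for z
  proof -
    have "0 \<le> s * metro_rate s (w z)" "s * metro_rate s (w z) \<le> 1"
      using metro_rate_le[OF s w_nonneg] metro_rate_nonneg[OF w_nonneg] s by auto
    then have "s * metro_rate s (w z) * \<bar>g z\<bar> \<le> 1"
      using g[of z] by (metis mult_le_one abs_ge_zero)
    then show ?thesis
      using \<open>0 \<le> s * metro_rate s (w z)\<close> s
      by (auto simp: metro_rate_def abs_mult mult.assoc w_nonneg split: split_indicator)
  qed
  then have h1: "\<bar>?h z\<bar> \<le> 1" for z
    by (rule order_trans) (auto split: split_indicator)
  have "(\<integral>z. (?h z)\<^sup>2 \<partial>\<beta>) \<le> (\<integral>z. indicator {z. w z \<le> s} z \<partial>\<beta>)"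
  proof (rule integral_mono)
    show "integrable \<beta> (\<lambda>z. (?h z)\<^sup>2)"
      using h1 by (intro \<beta>.integrable_const_bound[where B=1] AE_I2) (auto simp: abs_square_le_1 power_abs)
    show "integrable \<beta> (indicator {z. w z \<le> s} :: _ \<Rightarrow> real)"
      by (intro integrable_real_indicator) (auto simp: \<beta>.emeasure_eq_measure)
    show "(?h z)\<^sup>2 \<le> indicator {z. w z \<le> s} z" for z
      using h[of z] h1[of z] by (auto simp: abs_square_le_1 split: split_indicator)
  qed
  also have "\<dots> = \<beta>.prob {z. w z \<le> s}" by (simp add: space_\<beta>)
  \<comment> \<open>The level \<open>s\<close> need not be a value of \<open>w\<close>, so
    \<open>sublevel\<close> is first extended to all levels.\<close>
  also have "\<dots> \<le> K * s\<^sup>2"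
    using \<beta>.measure_sublevel_le[of w K s] sublevel w_nonneg K_nonneg by (simp add: space_\<beta>)
  finally have "sqrt (\<integral>z. (?h z)\<^sup>2 \<partial>\<beta>) \<le> sqrt K * s"
    using s real_sqrt_le_mono[of _ "K * s\<^sup>2"] by (simp add: real_sqrt_mult)
  then have "G * sqrt (\<integral>z. (?h z)\<^sup>2 \<partial>\<beta>) / sqrt n \<le> G * (sqrt K * s) / sqrt n"
    using G_nonneg by (intro divide_right_mono mult_left_mono) auto
  then have le: "(\<integral>\<^sup>+\<omega>. ennreal \<bar>emp_dev \<beta> (\<lambda>i. Y i \<omega>) n ?h\<bar> \<partial>M) \<le> ennreal (G * (sqrt K * s) / sqrt n)"
    by (intro order_trans[OF nn_integral_emp_dev_le[OF _ h1 n] ennreal_leI]) auto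
  have [measurable]: "(\<lambda>\<omega>. emp_dev \<beta> (\<lambda>i. Y i \<omega>) n ?h) \<in> borel_measurable M"
    unfolding emp_dev_def integral_emp[OF n] by measurable
  \<comment> \<open>Undoing the scaling gives a factor \<open>1 / s\<close> that cancels the
    \<open>s\<close> in the standard deviation bound \<open>sqrt K * s\<close>.\<close>
  have "emp_dev \<beta> (\<lambda>i. Y i \<omega>) n (\<lambda>z. metro_rate s (w z) * g z) = (1 / s) * emp_dev \<beta> (\<lambda>i. Y i \<omega>) n ?h" for \<omega>
    using s unfolding emp_dev_cmult by simp
  then have "(\<integral>\<^sup>+\<omega>. ennreal \<bar>emp_dev \<beta> (\<lambda>i. Y i \<omega>) n (\<lambda>z. metro_rate s (w z) * g z)\<bar> \<partial>M)
      = ennreal (1 / s) * (\<integral>\<^sup>+\<omega>. ennreal \<bar>emp_dev \<beta> (\<lambda>i. Y i \<omega>) n ?h\<bar> \<partial>M)"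
    using s by (subst nn_integral_cmult[symmetric]) (auto simp: abs_mult simp flip: ennreal_mult)
  also have "\<dots> \<le> ennreal (1 / s) * ennreal (G * (sqrt K * s) / sqrt n)"
    using le by (intro mult_left_mono) auto
  also have "\<dots> = ennreal (G * sqrt K / sqrt n)"
    using s G_nonneg K_nonneg by (subst ennreal_mult[symmetric]) auto
  finally show ?thesis .
qed

text \<open>The point \<open>X \<omega>\<close> may depend on the whole sample, because
  \<open>emp_dev_metro_le\<close> removes it pathwise. What remains are deviations of fixed
  functions: two of them bounded by 1, and one for each \<open>s\<close> in \<open>{0<..B}\<close>,
  which together give \<open>2 + B * sqrt K\<close>.\<close>

lemma nn_integral_emp_dev_metro_le:
  assumes [measurable]: "g \<in> borel_measurable borel" and g: "\<And>z. \<bar>g z\<bar> \<le> 1" and n: "n \<ge> 1"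
  shows "(\<integral>\<^sup>+\<omega>. ennreal \<bar>emp_dev \<beta> (\<lambda>i. Y i \<omega>) n (\<lambda>z. metro (w (X \<omega>)) (w z) * g z)\<bar> \<partial>M)
    \<le> ennreal (G * (2 + B * sqrt K) / sqrt n)"
proof -
  interpret P: pair_sigma_finite M lborel ..
  let ?D = "\<lambda>\<omega> f. ennreal \<bar>emp_dev \<beta> (\<lambda>i. Y i \<omega>) n f\<bar>"
  have Dm: "(\<lambda>\<omega>. ?D \<omega> f) \<in> borel_measurable M" if [measurable]: "f \<in> borel_measurable borel" for f
    unfolding emp_dev_def integral_emp[OF n] by measurable
  have Rm: "(\<lambda>(\<omega>, s). indicator {0<..B} s * ?D \<omega> (\<lambda>z. metro_rate s (w z) * g z))
      \<in> borel_measurable (M \<Otimes>\<^sub>M lborel)"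
    unfolding emp_dev_def integral_emp[OF n] by measurable
  have wB: "\<bar>w z / B * g z\<bar> \<le> 1" for z
  proof -
    have "w z / B * \<bar>g z\<bar> \<le> 1"
      using w_nonneg[of z] w_le[of z] B_ge_1 g[of z] by (intro mult_le_one) auto
    then show ?thesis using w_nonneg[of z] B_ge_1 by (simp add: abs_mult)
  qed
  have "(\<integral>\<^sup>+\<omega>. ?D \<omega> (\<lambda>z. metro (w (X \<omega>)) (w z) * g z) \<partial>M)
      \<le> (\<integral>\<^sup>+\<omega>. ?D \<omega> g + ?D \<omega> (\<lambda>z. w z / B * g z)
        + (\<integral>\<^sup>+s. indicator {0<..B} s * ?D \<omega> (\<lambda>z. metro_rate s (w z) * g z) \<partial>lborel) \<partial>M)"
    using w_nonneg w_le g
    by (intro nn_integral_mono emp_dev_metro_le sets_\<beta> \<beta>.prob_space_axioms) auto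
  also have "\<dots> = (\<integral>\<^sup>+\<omega>. ?D \<omega> g \<partial>M) + (\<integral>\<^sup>+\<omega>. ?D \<omega> (\<lambda>z. w z / B * g z) \<partial>M)
      + (\<integral>\<^sup>+\<omega>. (\<integral>\<^sup>+s. indicator {0<..B} s * ?D \<omega> (\<lambda>z. metro_rate s (w z) * g z) \<partial>lborel) \<partial>M)"
  proof -
    have "(\<lambda>\<omega>. ?D \<omega> (\<lambda>z. w z / B * g z)) \<in> borel_measurable M"
      by (rule Dm) measurable
    note d = Dm[OF assms(1)] this
    have d': "(\<lambda>\<omega>. ?D \<omega> g + ?D \<omega> (\<lambda>z. w z / B * g z)) \<in> borel_measurable M"
      using d by measurable
    have J: "(\<lambda>\<omega>. \<integral>\<^sup>+s. indicator {0<..B} s * ?D \<omega> (\<lambda>z. metro_rate s (w z) * g z) \<partial>lborel) \<in> borel_measurable M"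
      using lborel.borel_measurable_nn_integral_fst[OF Rm] by simp
    show ?thesis
      by (subst nn_integral_add[OF d' J], subst nn_integral_add[OF d]) (rule refl)
  qed
  \<comment> \<open>After the exchange the inner mean concerns one fixed function for each
    \<open>s\<close>, with a bound independent of \<open>s\<close>.\<close>
  also have "(\<integral>\<^sup>+\<omega>. (\<integral>\<^sup>+s. indicator {0<..B} s * ?D \<omega> (\<lambda>z. metro_rate s (w z) * g z) \<partial>lborel) \<partial>M)
      = (\<integral>\<^sup>+s. (\<integral>\<^sup>+\<omega>. indicator {0<..B} s * ?D \<omega> (\<lambda>z. metro_rate s (w z) * g z) \<partial>M) \<partial>lborel)"
    by (rule P.Fubini'[symmetric]) (rule Rm)
  also have "\<dots> \<le> (\<integral>\<^sup>+s. ennreal (G * sqrt K / sqrt n) * indicator {0<..B} s \<partial>lborel)"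
    using nn_integral_emp_dev_rate_le[OF assms(1) g n]
    by (intro nn_integral_mono) (auto split: split_indicator)
  also have "\<dots> = ennreal (G * sqrt K / sqrt n * B)"
    using B_ge_1 G_nonneg K_nonneg
    by (simp add: nn_integral_cmult_indicator ennreal_mult' del: times_divide_eq_left)
  finally have bound: "(\<integral>\<^sup>+\<omega>. ?D \<omega> (\<lambda>z. metro (w (X \<omega>)) (w z) * g z) \<partial>M)
      \<le> (\<integral>\<^sup>+\<omega>. ?D \<omega> g \<partial>M) + (\<integral>\<^sup>+\<omega>. ?D \<omega> (\<lambda>z. w z / B * g z) \<partial>M) + ennreal (G * sqrt K / sqrt n * B)"
    by (rule order_trans[OF _ add_left_mono]) simp_all
  have wBg: "(\<lambda>z. w z / B * g z) \<in> borel_measurable borel" by measurable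
  note bound
  also have "(\<integral>\<^sup>+\<omega>. ?D \<omega> g \<partial>M) + (\<integral>\<^sup>+\<omega>. ?D \<omega> (\<lambda>z. w z / B * g z) \<partial>M) + ennreal (G * sqrt K / sqrt n * B)
      \<le> ennreal (G / sqrt n) + ennreal (G / sqrt n) + ennreal (G * sqrt K / sqrt n * B)"
    by (intro add_mono order_refl nn_integral_emp_dev_le_unit[OF assms(1) g n]
        nn_integral_emp_dev_le_unit[OF wBg wB n])
  also have "\<dots> = ennreal (G / sqrt n + G / sqrt n + G * sqrt K / sqrt n * B)"
    using G_nonneg K_nonneg B_ge_1 by (subst ennreal_plus, simp, simp)+
  also have "G / sqrt n + G / sqrt n + G * sqrt K / sqrt n * B = G * (2 + B * sqrt K) / sqrt n"
    by (simp add: algebra_simps add_divide_distrib)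
  finally show ?thesis .
qed

end

subsection \<open>The error recursion\<close>

text \<open>Up to \<open>n = 2 / \<delta>\<close> the trivial bound 1 suffices, by the choice of the
  second entry of the maximum. Beyond that, half of the contraction \<delta> absorbs the noise
  \<open>c\<close> and the other half absorbs the decrease of \<open>1 / sqrt n\<close> in one
  step.\<close>

lemma recursion_le_inverse_sqrt:
  fixes e :: "nat \<Rightarrow> real"
  assumes \<delta>: "0 < \<delta>" "\<delta> \<le> 1" and "0 \<le> c" and bdd: "\<And>n. n \<ge> 1 \<Longrightarrow> e n \<le> 1"
    and step: "\<And>n. n \<ge> 1 \<Longrightarrow> e (Suc n) \<le> (1 - \<delta>) * e n + c / sqrt n"
    and n: "n \<ge> 1"
  shows "e n \<le> max (2 * c / \<delta>) (sqrt (2 / \<delta>)) / sqrt n"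
proof -
  let ?L = "max (2 * c / \<delta>) (sqrt (2 / \<delta>))"
  have small: "e m \<le> ?L / sqrt m" if "m \<ge> 1" "m \<le> 2 / \<delta>" for m
  proof -
    have "1 \<le> sqrt (2 / \<delta>) / sqrt m"
      using that by simp
    also have "\<dots> \<le> ?L / sqrt m" by (intro divide_right_mono) auto
    finally show ?thesis using bdd[OF that(1)] by simp
  qed
  show ?thesis using n
  proof (induction n rule: nat_induct_at_least)
    case base
    show ?case using small[of 1] \<delta> by simp
  next
    case (Suc n)
    show ?case
    proof (cases "real (Suc n) \<le> 2 / \<delta>")
      case True
      then show ?thesis using small[of "Suc n"] by simp
    next
      case False
      \<comment> \<open>Past the threshold \<open>1 / Suc n\<close> is less than
        \<open>\<delta> / 2\<close>; the next step uses that a number in [0, 1] is at most its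
        square root.\<close>
      then have "1 - \<delta> / 2 \<le> real n / real (Suc n)"
        using \<delta> by (simp add: field_simps)
      also have "\<dots> \<le> sqrt (real n / real (Suc n))"
        using mult_left_le[of "real n / real (Suc n)" "real n / real (Suc n)"]
        by (intro real_le_rsqrt) (simp only: power2_eq_square, simp)
      finally have r: "(1 - \<delta> / 2) / sqrt n \<le> 1 / sqrt (Suc n)"
        using Suc.hyps by (simp add: real_sqrt_divide field_simps)
      have "e (Suc n) \<le> (1 - \<delta>) * (?L / sqrt n) + c / sqrt n"
        using step[OF Suc.hyps] mult_left_mono[OF Suc.IH, of "1 - \<delta>"] \<delta> by simp
      also have "c / sqrt n \<le> \<delta> / 2 * ?L / sqrt n"
      proof (rule divide_right_mono)
        have "2 * c / \<delta> \<le> ?L" by simp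
        then show "c \<le> \<delta> / 2 * ?L" using \<delta> by (simp add: field_simps del: max.cobounded1 max.cobounded2)
      qed simp
      also have "(1 - \<delta>) * (?L / sqrt n) + \<delta> / 2 * ?L / sqrt n = ?L * ((1 - \<delta> / 2) / sqrt n)"
        by (simp add: algebra_simps add_divide_distrib diff_divide_distrib)
      also have "\<dots> \<le> ?L * (1 / sqrt (Suc n))"
        using r \<delta> by (intro mult_left_mono) (auto simp: le_max_iff_disj)
      finally show ?thesis by simp
    qed
  qed
qed

text \<open>Adds the main chain. Stationarity of \<open>P\<close> and the transition law of
  \<open>X\<close> are phrased with \<open>target\<close> and \<open>kern\<close>, so they enter
  later, as hypotheses of \<open>expectation_target_diff_le\<close>. \<open>w_int\<close> makes
  \<open>w\<close> a probability density with respect to \<beta>.\<close>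

locale equi_energy = empirical_metropolis M \<beta> Y w B C K
  for M :: "'b measure" and \<beta> :: "'a::topological_space measure" and Y w B C K +
  fixes X :: "nat \<Rightarrow> 'b \<Rightarrow> 'a" and P :: "'a \<Rightarrow> 'a measure" and \<epsilon> :: real
  assumes X_measurable [measurable]: "\<And>n. X n \<in> M \<rightarrow>\<^sub>M borel"
    and P_kernel: "P \<in> borel \<rightarrow>\<^sub>M prob_algebra borel"
    and \<epsilon>: "0 < \<epsilon>" "\<epsilon> < 1"
    and w_int: "(\<integral>z. w z \<partial>\<beta>) = 1"
begin

text \<open>The kernel \<open>P\<^sub>\<theta>\<close> acting on functions, written through the density ratio \<open>w = \<pi> / \<pi>\<^sub>Y\<close>;
  below \<open>\<beta>\<close> is \<open>\<pi>\<^sub>Y\<close>, and \<open>target\<close> is integration against \<open>\<pi>\<close>.\<close>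

definition kern :: "'a measure \<Rightarrow> ('a \<Rightarrow> real) \<Rightarrow> 'a \<Rightarrow> real" where
  "kern \<theta> f x = (1 - \<epsilon>) * (\<integral>y. f y \<partial>P x)
     + \<epsilon> * ((1 - (\<integral>z. metro (w x) (w z) \<partial>\<theta>)) * f x + (\<integral>z. metro (w x) (w z) * f z \<partial>\<theta>))"

definition target :: "('a \<Rightarrow> real) \<Rightarrow> real" where
  "target f = (\<integral>z. w z * f z \<partial>\<beta>)"

text \<open>The contraction argument needs a class closed under \<open>1 - f\<close> and under the
  normalized remainder of the limiting kernel; the unit interval as range makes both immediate.
  General bounded functions are reduced to it by an affine map.\<close>

abbreviation test :: "('a \<Rightarrow> real) \<Rightarrow> bool" where
  "test f \<equiv> f \<in> borel_measurable borel \<and> (\<forall>x. 0 \<le> f x \<and> f x \<le> 1)"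

section \<open>Measurability and bounds for the kernels\<close>

lemma P_measurable [measurable]: "P \<in> borel \<rightarrow>\<^sub>M subprob_algebra borel"
  using P_kernel by (rule measurable_prob_algebraD)

lemma P_prob: "prob_space (P x)" and sets_P [measurable_cong]: "sets (P x) = sets borel"
  using measurable_space[OF P_kernel, of x] by (auto simp: space_prob_algebra)

lemma integrable_P: "test f \<Longrightarrow> integrable (P x) f"
  using sets_P by (intro finite_measure.integrable_const_bound[where B=1] AE_I2 prob_space.finite_measure P_prob)
    (auto cong: measurable_cong_sets)

lemma integral_P_bounds:
  assumes "test f"
  shows "0 \<le> (\<integral>y. f y \<partial>P x)" "(\<integral>y. f y \<partial>P x) \<le> 1"
  using assms by (auto intro!: integral_nonneg_AE prob_space.integral_le_const[OF P_prob] integrable_P)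

lemma measurable_integral_P [measurable]:
  fixes f :: "'a \<Rightarrow> real"
  assumes [measurable]: "f \<in> borel_measurable borel"
  shows "(\<lambda>x. \<integral>y. f y \<partial>P x) \<in> borel_measurable borel"
  using measurable_compose[OF P_measurable integral_measurable_subprob_algebra[OF assms]] .

lemma integrable_\<beta>:
  fixes f :: "'a \<Rightarrow> real"
  assumes "f \<in> borel_measurable borel" "\<And>z. \<bar>f z\<bar> \<le> a"
  shows "integrable \<beta> f"
  using assms by (intro \<beta>.integrable_const_bound[where B=a]) auto

lemma integrable_w: "integrable \<beta> w"
  using w_nonneg w_le by (intro integrable_\<beta>[of _ B]) auto

lemma integrable_w_times:
  assumes "test f"
  shows "integrable \<beta> (\<lambda>z. w z * f z)"
  using assms w_nonneg w_le
  by (intro integrable_\<beta>[of _ B]) (auto simp: abs_mult intro: order_trans[OF mult_left_le])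

lemma measurable_kern_\<beta> [measurable]:
  assumes [measurable]: "f \<in> borel_measurable borel"
  shows "kern \<beta> f \<in> borel_measurable borel"
  unfolding kern_def[abs_def] by measurable

lemma measurable_kern_emp [measurable]:
  assumes [measurable]: "f \<in> borel_measurable borel" and n: "n \<ge> 1"
  shows "(\<lambda>\<omega>. kern (emp (\<lambda>i. Y i \<omega>) n) f (X n \<omega>)) \<in> borel_measurable M"
  unfolding kern_def[abs_def] integral_emp[OF n] by measurable

text \<open>Measurability is assumed with respect to \<theta> itself, so that \<beta> and the
  empirical measures are both covered.\<close>

lemma metro_integral_bounds:
  assumes "prob_space \<theta>" "(\<lambda>z. metro (w x) (w z)) \<in> borel_measurable \<theta>" "f \<in> borel_measurable \<theta>"
    and f: "\<And>z. 0 \<le> f z" "\<And>z. f z \<le> 1"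
  shows "0 \<le> (\<integral>z. metro (w x) (w z) * f z \<partial>\<theta>)"
    and "(\<integral>z. metro (w x) (w z) * f z \<partial>\<theta>) \<le> (\<integral>z. metro (w x) (w z) \<partial>\<theta>)"
    and "(\<integral>z. metro (w x) (w z) \<partial>\<theta>) \<le> 1"
proof -
  interpret \<theta>: prob_space \<theta> by fact
  have b: "0 \<le> metro (w x) (w z)" "metro (w x) (w z) \<le> 1" for z
    using metro_bounds w_nonneg by auto
  have I: "integrable \<theta> (\<lambda>z. metro (w x) (w z))" "integrable \<theta> (\<lambda>z. metro (w x) (w z) * f z)"
    using assms b by (auto intro!: \<theta>.integrable_const_bound[where B=1] simp: abs_mult mult_le_one)
  show "0 \<le> (\<integral>z. metro (w x) (w z) * f z \<partial>\<theta>)"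
    using b f by (intro integral_nonneg_AE) auto
  show "(\<integral>z. metro (w x) (w z) * f z \<partial>\<theta>) \<le> (\<integral>z. metro (w x) (w z) \<partial>\<theta>)"
    using I b f by (intro integral_mono) (auto intro: mult_left_le)
  show "(\<integral>z. metro (w x) (w z) \<partial>\<theta>) \<le> 1"
    using I b by (intro \<theta>.integral_le_const) auto
qed

lemma kern_bounds:
  assumes f: "test f" and "prob_space \<theta>" "(\<lambda>z. metro (w x) (w z)) \<in> borel_measurable \<theta>" "f \<in> borel_measurable \<theta>"
  shows "0 \<le> kern \<theta> f x" "kern \<theta> f x \<le> 1"
proof -
  let ?a = "\<integral>z. metro (w x) (w z) \<partial>\<theta>" and ?b = "\<integral>z. metro (w x) (w z) * f z \<partial>\<theta>"
  have *: "0 \<le> ?b" "?b \<le> ?a" "?a \<le> 1"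
    using metro_integral_bounds[of \<theta> x f] assms by auto
  have "0 \<le> (1 - ?a) * f x" "(1 - ?a) * f x \<le> 1 - ?a"
    using * f by (auto intro: mult_left_le)
  with * have "0 \<le> (1 - ?a) * f x + ?b" "(1 - ?a) * f x + ?b \<le> 1" by linarith+
  then have 1: "0 \<le> \<epsilon> * ((1 - ?a) * f x + ?b)" "\<epsilon> * ((1 - ?a) * f x + ?b) \<le> \<epsilon>"
    using \<epsilon> by (auto intro: mult_left_le)
  have 2: "0 \<le> (1 - \<epsilon>) * (\<integral>y. f y \<partial>P x)" "(1 - \<epsilon>) * (\<integral>y. f y \<partial>P x) \<le> 1 - \<epsilon>"
    using integral_P_bounds[OF f] \<epsilon> by (auto intro: mult_left_le)
  show "0 \<le> kern \<theta> f x" "kern \<theta> f x \<le> 1"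
    using 1 2 unfolding kern_def by linarith+
qed

lemma target_bounds:
  assumes "test f"
  shows "0 \<le> target f" "target f \<le> 1"
proof -
  have "target f \<le> (\<integral>z. w z \<partial>\<beta>)"
    unfolding target_def using assms w_nonneg integrable_w integrable_w_times[OF assms] by (intro integral_mono) (auto intro: mult_left_le)
  then show "target f \<le> 1" by (simp add: w_int)
  show "0 \<le> target f"
    unfolding target_def using assms w_nonneg by (intro integral_nonneg_AE) auto
qed

text \<open>The limiting kernel is linear and preserves constants. Together with
  \<open>target_one_minus\<close> this turns the lower bound \<open>kern_ge\<close> into an upper
  bound.\<close>

lemma kern_one_minus:
  assumes f: "test f"
  shows "kern \<beta> (\<lambda>x. 1 - f x) x = 1 - kern \<beta> f x"
proof -
  have b: "0 \<le> metro (w x) (w z)" "metro (w x) (w z) \<le> 1" for z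
    using metro_bounds w_nonneg by auto
  have I: "integrable \<beta> (\<lambda>z. metro (w x) (w z))" "integrable \<beta> (\<lambda>z. metro (w x) (w z) * f z)"
    using f b by (auto intro!: integrable_\<beta>[of _ 1] simp: abs_mult mult_le_one)
  have P1: "(\<integral>y. 1 - f y \<partial>P x) = 1 - (\<integral>y. f y \<partial>P x)"
    using integrable_P[OF f] prob_space.prob_space[OF P_prob]
    by (subst Bochner_Integration.integral_diff)
      (auto intro: finite_measure.integrable_const prob_space.finite_measure P_prob)
  have \<beta>1: "(\<integral>z. metro (w x) (w z) * (1 - f z) \<partial>\<beta>)
      = (\<integral>z. metro (w x) (w z) \<partial>\<beta>) - (\<integral>z. metro (w x) (w z) * f z \<partial>\<beta>)"
    using I by (subst Bochner_Integration.integral_diff[symmetric]) (auto simp: right_diff_distrib)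
  show ?thesis unfolding kern_def P1 \<beta>1 by (simp add: algebra_simps)
qed

lemma target_one_minus:
  assumes f: "test f"
  shows "target (\<lambda>x. 1 - f x) = 1 - target f"
  using integrable_w integrable_w_times[OF f]
  unfolding target_def right_diff_distrib by (simp add: w_int)

text \<open>A Doeblin minorization: since \<open>w x \<le> B\<close>, the acceptance probability is
  at least \<open>w z / B\<close>, so accepted proposals alone contribute
  \<open>target f / B\<close>. The holding part and the \<open>P\<close> part are
  nonnegative.\<close>

lemma kern_ge:
  assumes f: "test f"
  shows "\<epsilon> / B * target f \<le> kern \<beta> f x"
proof -
  let ?a = "\<integral>z. metro (w x) (w z) \<partial>\<beta>" and ?b = "\<integral>z. metro (w x) (w z) * f z \<partial>\<beta>"
  have b: "0 \<le> metro (w x) (w z)" "metro (w x) (w z) \<le> 1" for z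
    using metro_bounds w_nonneg by auto
  have "w z / B \<le> metro (w x) (w z)" for z
    using w_nonneg[of z] w_nonneg[of x] w_le[of z] w_le[of x] B_ge_1
    by (auto simp: metro_def intro!: divide_left_mono mult_pos_pos)
  moreover have "integrable \<beta> (\<lambda>z. metro (w x) (w z) * f z)"
    using f b by (auto intro!: integrable_\<beta>[of _ 1] simp: abs_mult mult_le_one)
  moreover have "integrable \<beta> (\<lambda>z. w z * f z)"
    by (rule integrable_w_times[OF f])
  ultimately have "(\<integral>z. (w z / B) * f z \<partial>\<beta>) \<le> ?b"
    using f by (intro integral_mono mult_right_mono) auto
  then have 1: "target f / B \<le> ?b" by (simp add: target_def)
  have [measurable]: "f \<in> borel_measurable borel" using f by simp
  have "?a \<le> 1"
    by (rule metro_integral_bounds(3)[where f = f]) (use f \<beta>.prob_space_axioms in auto)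
  then have "0 \<le> (1 - ?a) * f x" using f by simp
  with 1 have "\<epsilon> * (target f / B) \<le> \<epsilon> * ((1 - ?a) * f x + ?b)"
    using \<epsilon> by (intro mult_left_mono) auto
  moreover have "0 \<le> (1 - \<epsilon>) * (\<integral>y. f y \<partial>P x)"
    using integral_P_bounds[OF f] \<epsilon> by simp
  ultimately show ?thesis unfolding kern_def by simp
qed

text \<open>Detailed balance: the flow \<^term>\<open>w x * metro (w x) (w z) = min (w x) (w z)\<close> is symmetric.\<close>

lemma target_kern:
  assumes f: "test f" and stat: "target (\<lambda>x. \<integral>y. f y \<partial>P x) = target f"
  shows "target (kern \<beta> f) = target f"
proof -
  interpret \<beta>\<beta>: pair_prob_space \<beta> \<beta> ..
  have [measurable]: "f \<in> borel_measurable borel" using f by simp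
  have b: "0 \<le> metro (w x) (w z)" "metro (w x) (w z) \<le> 1" for x z
    using metro_bounds w_nonneg by auto
  define m where "m x z = min (w x) (w z)" for x z
  \<comment> \<open>Multiplying by \<open>w x\<close> removes the quotient, also where
    \<open>w x = 0\<close>: both sides are then 0.\<close>
  have m_eq: "w x * metro (w x) (w z) = m x z" for x z
    using w_nonneg[of x] w_nonneg[of z] by (auto simp: metro_def m_def min_def field_simps)
  have m_sym: "m x z = m z x" for x z by (simp add: m_def min.commute)
  have mf: "\<bar>m x z * f y\<bar> \<le> B" for x y z
    using w_nonneg[of x] w_nonneg[of z] w_le[of x] f mult_left_le[of "f y" "m x z"]
    by (auto simp: m_def abs_mult)
  have I1: "integrable (\<beta> \<Otimes>\<^sub>M \<beta>) (\<lambda>(x, z). m x z * f z)"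
    and I2: "integrable (\<beta> \<Otimes>\<^sub>M \<beta>) (\<lambda>(x, z). m x z * f x)"
    using mf by (auto intro!: \<beta>\<beta>.integrable_const_bound[where B=B] simp: m_def case_prod_beta)
  \<comment> \<open>Exchanging the two variables turns inflow into outflow, so the accepted and the
    rejected part of the move cancel in the mean.\<close>
  have swap: "(\<integral>x. (\<integral>z. m x z * f z \<partial>\<beta>) \<partial>\<beta>) = (\<integral>x. (\<integral>z. m x z * f x \<partial>\<beta>) \<partial>\<beta>)"
    using \<beta>\<beta>.Fubini_integral[OF I2] by (subst m_sym) simp
  have J1: "integrable \<beta> (\<lambda>x. \<integral>z. m x z * f z \<partial>\<beta>)" and J2: "integrable \<beta> (\<lambda>x. \<integral>z. m x z * f x \<partial>\<beta>)"
    using \<beta>\<beta>.integrable_fst'[OF I1] \<beta>\<beta>.integrable_fst'[OF I2] by auto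
  have tP: "test (\<lambda>x. \<integral>y. f y \<partial>P x)"
    using integral_P_bounds[OF f] by auto
  have "w x * kern \<beta> f x = (1 - \<epsilon>) * (w x * (\<integral>y. f y \<partial>P x))
      + (\<epsilon> * (w x * f x) + (\<epsilon> * (\<integral>z. m x z * f z \<partial>\<beta>) - \<epsilon> * (\<integral>z. m x z * f x \<partial>\<beta>)))" for x
  proof -
    have "(\<integral>z. m x z * f z \<partial>\<beta>) = w x * (\<integral>z. metro (w x) (w z) * f z \<partial>\<beta>)"
      by (simp flip: m_eq add: mult.assoc)
    moreover have "(\<integral>z. m x z * f x \<partial>\<beta>) = w x * ((\<integral>z. metro (w x) (w z) \<partial>\<beta>) * f x)"
      by (simp flip: m_eq add: mult.assoc)
    ultimately show ?thesis by (simp add: kern_def algebra_simps)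
  qed
  then have "target (kern \<beta> f) = (1 - \<epsilon>) * target (\<lambda>x. \<integral>y. f y \<partial>P x)
      + (\<epsilon> * target f + (\<epsilon> * (\<integral>x. (\<integral>z. m x z * f z \<partial>\<beta>) \<partial>\<beta>) - \<epsilon> * (\<integral>x. (\<integral>z. m x z * f x \<partial>\<beta>) \<partial>\<beta>)))"
    unfolding target_def using integrable_w_times[OF f] integrable_w_times[OF tP] J1 J2
    by simp
  then show ?thesis unfolding swap stat by (simp add: algebra_simps)
qed

text \<open>The \<open>P\<close> part is common to both kernels and cancels. The rest is \<epsilon>
  times the deviation of the acceptance probability against \<open>f\<close>, minus
  \<open>f (X n \<omega>)\<close> times its deviation against 1; each is bounded by
  \<open>nn_integral_emp_dev_metro_le\<close>, hence the factor 2.\<close>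

lemma kern_perturbation:
  assumes f: "test f" and n: "n \<ge> 1"
  shows "expectation (\<lambda>\<omega>. \<bar>kern (emp (\<lambda>i. Y i \<omega>) n) f (X n \<omega>) - kern \<beta> f (X n \<omega>)\<bar>)
    \<le> 2 * G * (2 + B * sqrt K) / sqrt n"
proof -
  have [measurable]: "f \<in> borel_measurable borel" using f by simp
  let ?c = "G * (2 + B * sqrt K) / sqrt n"
  have c: "0 \<le> ?c" using G_nonneg B_ge_1 K_nonneg by simp
  let ?D = "\<lambda>g \<omega>. emp_dev \<beta> (\<lambda>i. Y i \<omega>) n (\<lambda>z. metro (w (X n \<omega>)) (w z) * g z)"
  let ?k = "\<lambda>\<omega>. kern (emp (\<lambda>i. Y i \<omega>) n) f (X n \<omega>) - kern \<beta> f (X n \<omega>)"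
  have D [measurable]: "?D g \<in> borel_measurable M" if [measurable]: "g \<in> borel_measurable borel" for g
    unfolding emp_dev_def integral_emp[OF n] by measurable
  have [measurable]: "?k \<in> borel_measurable M"
    using measurable_kern_emp[OF _ n, of f] by measurable
  have "\<bar>?k \<omega>\<bar> \<le> \<bar>?D f \<omega>\<bar> + \<bar>?D (\<lambda>_. 1) \<omega>\<bar>" for \<omega>
  proof -
    have "?k \<omega> = \<epsilon> * (?D f \<omega> - f (X n \<omega>) * ?D (\<lambda>_. 1) \<omega>)"
      by (simp add: kern_def emp_dev_def algebra_simps)
    then have "\<bar>?k \<omega>\<bar> \<le> 1 * \<bar>?D f \<omega> - f (X n \<omega>) * ?D (\<lambda>_. 1) \<omega>\<bar>"
      using \<epsilon> by (simp add: abs_mult mult_left_le_one_le)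
    also have "\<dots> \<le> \<bar>?D f \<omega>\<bar> + \<bar>f (X n \<omega>) * ?D (\<lambda>_. 1) \<omega>\<bar>" by simp
    also have "\<bar>f (X n \<omega>) * ?D (\<lambda>_. 1) \<omega>\<bar> \<le> 1 * \<bar>?D (\<lambda>_. 1) \<omega>\<bar>"
      unfolding abs_mult using f by (intro mult_right_mono) auto
    finally show ?thesis by simp
  qed
  then have "(\<integral>\<^sup>+\<omega>. ennreal \<bar>?k \<omega>\<bar> \<partial>M) \<le> (\<integral>\<^sup>+\<omega>. ennreal \<bar>?D f \<omega>\<bar> + ennreal \<bar>?D (\<lambda>_. 1) \<omega>\<bar> \<partial>M)"
    by (intro nn_integral_mono) (simp flip: ennreal_plus)
  also have "\<dots> = (\<integral>\<^sup>+\<omega>. ennreal \<bar>?D f \<omega>\<bar> \<partial>M) + (\<integral>\<^sup>+\<omega>. ennreal \<bar>?D (\<lambda>_. 1) \<omega>\<bar> \<partial>M)"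
    using D[of f] D[of "\<lambda>_. 1"] by (intro nn_integral_add) auto
  also have "\<dots> \<le> ennreal ?c + ennreal ?c"
    using f nn_integral_emp_dev_metro_le[of f n "X n"] nn_integral_emp_dev_metro_le[of "\<lambda>_. 1" n "X n"] n
    by (intro add_mono) auto
  also have "\<dots> = ennreal (2 * ?c)" using c by (simp flip: ennreal_plus)
  finally have "(\<integral>\<^sup>+\<omega>. ennreal \<bar>?k \<omega>\<bar> \<partial>M) \<le> ennreal (2 * ?c)" .
  then have "expectation (\<lambda>\<omega>. \<bar>?k \<omega>\<bar>) \<le> 2 * ?c"
    using c by (subst integral_eq_nn_integral) (auto intro!: enn2real_leI)
  then show ?thesis by (simp add: mult.assoc)
qed

text \<open>One step of the chain contracts the error by the minorization \<open>\<epsilon> / B\<close> of the limiting kernel,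
  up to the error made by replacing \<^term>\<open>\<beta>\<close> by the empirical measure.\<close>

lemma expectation_target_diff_le:
  assumes stat: "\<And>f. test f \<Longrightarrow> target (\<lambda>x. \<integral>y. f y \<partial>P x) = target f"
    and step: "\<And>n f. n \<ge> 1 \<Longrightarrow> test f \<Longrightarrow>
      expectation (\<lambda>\<omega>. f (X (Suc n) \<omega>)) = expectation (\<lambda>\<omega>. kern (emp (\<lambda>i. Y i \<omega>) n) f (X n \<omega>))"
  shows "\<exists>L\<ge>0. \<forall>n\<ge>1. \<forall>f. test f \<longrightarrow> \<bar>expectation (\<lambda>\<omega>. f (X n \<omega>)) - target f\<bar> \<le> L / sqrt n"
proof -
  define \<delta> where "\<delta> = \<epsilon> / B"
  have \<delta>: "0 < \<delta>" "\<delta> < 1" using \<epsilon> B_ge_1 by (auto simp: \<delta>_def)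
  define c where "c = 2 * G * (2 + B * sqrt K)"
  have c: "0 \<le> c" using G_nonneg B_ge_1 K_nonneg by (simp add: c_def)
  define err where "err n f = \<bar>expectation (\<lambda>\<omega>. f (X n \<omega>)) - target f\<bar>" for n f
  \<comment> \<open>The recursion passes from \<open>f\<close> at time \<open>Suc n\<close> to
    another function at time \<open>n\<close>, so the error is taken uniformly over the whole
    class.\<close>
  define e where "e n = (SUP f\<in>{f. test f}. err n f)" for n
  have Xint: "integrable M (\<lambda>\<omega>. f (X n \<omega>))" if "test f" for f n
    using that by (intro integrable_const_bound[where B=1]) auto
  have err_le: "err n f \<le> 1" if "test f" for n f
  proof -
    have "0 \<le> expectation (\<lambda>\<omega>. f (X n \<omega>))" "expectation (\<lambda>\<omega>. f (X n \<omega>)) \<le> 1"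
      using that Xint[OF that] by (auto intro!: integral_nonneg_AE integral_le_const)
    then show ?thesis using target_bounds[OF that] unfolding err_def by linarith
  qed
  have bdd: "bdd_above (err n ` {f. test f})" for n
    using err_le by (intro bdd_aboveI2[where M = 1]) auto
  have ne: "{f. test f} \<noteq> {}" by (auto intro!: exI[of _ "\<lambda>_. 0"])
  have err_e: "err n f \<le> e n" if "test f" for n f
    unfolding e_def using that bdd by (intro cSUP_upper) auto
  have "err (Suc n) f \<le> (1 - \<delta>) * e n + c / sqrt n" if n: "n \<ge> 1" and f: "test f" for n f
  proof -
    have [measurable]: "f \<in> borel_measurable borel" using f by simp
    \<comment> \<open>The remainder of the kernel once the minorizing mass \<delta> is split off,
      renormalized to total mass 1.\<close>
    define h where "h x = (kern \<beta> f x - \<delta> * target f) / (1 - \<delta>)" for x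
    have tf: "test (\<lambda>x. 1 - f x)" using f by auto
    \<comment> \<open>The minorization for \<open>f\<close> gives \<open>0 \<le> h x\<close>, the
      one for \<open>1 - f\<close> gives \<open>h x \<le> 1\<close>.\<close>
    have "\<delta> * target f \<le> kern \<beta> f x" "kern \<beta> f x - \<delta> * target f \<le> 1 - \<delta>" for x
      using kern_ge[OF f, of x] kern_ge[OF tf, of x]
      by (simp_all add: kern_one_minus[OF f] target_one_minus[OF f] \<delta>_def algebra_simps)
    then have h: "test h"
      using \<delta> unfolding h_def by auto
    have kh: "kern \<beta> f x = (1 - \<delta>) * h x + \<delta> * target f" for x
      using \<delta> by (simp add: h_def)
    have "target (kern \<beta> f) = (1 - \<delta>) * target h + \<delta> * target f"
    proof -
      have "w x * kern \<beta> f x = (1 - \<delta>) * (w x * h x) + \<delta> * target f * w x" for x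
        by (simp add: kh algebra_simps)
      then show ?thesis unfolding target_def[of "kern \<beta> f"] using integrable_w integrable_w_times[OF h]
        by (simp add: w_int target_def[of h])
    qed
    \<comment> \<open>Since the limiting kernel and the split-off part both preserve the target, so
      does the remainder.\<close>
    then have th: "(1 - \<delta>) * target h = (1 - \<delta>) * target f"
      using target_kern[OF f stat[OF f]] by (simp add: algebra_simps)
    \<comment> \<open>The split-off part is constant in \<open>x\<close> and drops out of the error;
      this is the source of the factor \<open>1 - \<delta>\<close>.\<close>
    have Ek: "expectation (\<lambda>\<omega>. kern \<beta> f (X n \<omega>)) - target f = (1 - \<delta>) * (expectation (\<lambda>\<omega>. h (X n \<omega>)) - target h)"
      unfolding kh using Xint[OF h] th by (simp add: prob_space algebra_simps)
    let ?k = "\<lambda>\<omega>. kern (emp (\<lambda>i. Y i \<omega>) n) f (X n \<omega>)"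
    have I1: "integrable M ?k"
      using kern_bounds[OF f prob_space_emp] measurable_kern_emp[OF _ n, of f]
      by (intro integrable_const_bound[where B=1]) auto
    have I2: "integrable M (\<lambda>\<omega>. kern \<beta> f (X n \<omega>))"
      using kern_bounds[OF f \<beta>.prob_space_axioms] by (intro integrable_const_bound[where B=1]) auto
    have "\<bar>expectation ?k - expectation (\<lambda>\<omega>. kern \<beta> f (X n \<omega>))\<bar>
        \<le> expectation (\<lambda>\<omega>. \<bar>?k \<omega> - kern \<beta> f (X n \<omega>)\<bar>)"
      using integral_abs_bound[of M "\<lambda>\<omega>. ?k \<omega> - kern \<beta> f (X n \<omega>)"] I1 I2 by simp
    also have "\<dots> \<le> c / sqrt n"
      using kern_perturbation[OF f n] by (simp add: c_def)
    finally have "err (Suc n) f \<le> \<bar>expectation (\<lambda>\<omega>. kern \<beta> f (X n \<omega>)) - target f\<bar> + c / sqrt n"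
      unfolding err_def step[OF n f] by linarith
    also have "\<bar>expectation (\<lambda>\<omega>. kern \<beta> f (X n \<omega>)) - target f\<bar> = (1 - \<delta>) * err n h"
      unfolding Ek err_def using \<delta> by (simp add: abs_mult)
    also have "\<dots> \<le> (1 - \<delta>) * e n"
      using err_e[OF h] \<delta> by (intro mult_left_mono) auto
    finally show ?thesis by simp
  qed
  then have "e (Suc n) \<le> (1 - \<delta>) * e n + c / sqrt n" if "n \<ge> 1" for n
    unfolding e_def[of "Suc n"] using that ne by (intro cSUP_least) auto
  moreover have "e n \<le> 1" for n
    unfolding e_def using ne err_le by (intro cSUP_least) auto
  ultimately have "e n \<le> max (2 * c / \<delta>) (sqrt (2 / \<delta>)) / sqrt n" if "n \<ge> 1" for n
    using \<delta> c that by (intro recursion_le_inverse_sqrt) auto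
  then have "\<forall>n\<ge>1. \<forall>f. test f \<longrightarrow> err n f \<le> max (2 * c / \<delta>) (sqrt (2 / \<delta>)) / sqrt n"
    using err_e order_trans by blast
  then show ?thesis
    unfolding err_def using \<delta>
    by (intro exI[of _ "max (2 * c / \<delta>) (sqrt (2 / \<delta>))"]) (auto simp: le_max_iff_disj)
qed

end

subsection \<open>Transfer to the sampler\<close>

lemma subalgebra_gen_sa:
  assumes "\<And>Z. Z \<in> S \<Longrightarrow> Z \<in> M \<rightarrow>\<^sub>M borel"
  shows "subalgebra M (gen_sa M S)"
proof -
  let ?A = "\<Union>Z\<in>S. {Z -` A \<inter> space M | A. A \<in> sets borel}"
  have "?A \<subseteq> sets M"
    using assms by (auto intro: measurable_sets)
  moreover from this have "?A \<subseteq> Pow (space M)"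
    using sets.sets_into_space by blast
  ultimately show ?thesis
    unfolding subalgebra_def gen_sa_def by (simp add: space_measure_of sets_measure_of sets.sigma_sets_subset)
qed

text \<open>The tower property, from the defining identity with constant weight 1.\<close>

lemma (in prob_space) nn_integral_nn_cond_exp:
  assumes "subalgebra M F" "h \<in> borel_measurable M"
  shows "(\<integral>\<^sup>+\<omega>. nn_cond_exp M F h \<omega> \<partial>M) = (\<integral>\<^sup>+\<omega>. h \<omega> \<partial>M)"
proof -
  interpret finite_measure_subalgebra M F
    by unfold_locales (rule assms)
  show ?thesis
    using nn_cond_exp_intg[of "\<lambda>_. 1" h] assms by simp
qed

text \<open>Dividing through by \<open>pY x * pY z\<close> leaves only density ratios. If
  \<open>p x = 0\<close>, both sides take their default value 1.\<close>

lemma accept_eq_metro: "pY x > 0 \<Longrightarrow> pY z > 0 \<Longrightarrow> accept p pY x z = metro (p x / pY x) (p z / pY z)"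
  by (auto simp: accept_def metro_def field_simps)

text \<open>Links the extended nonnegative operator of the transition law to the real-valued kernel
  of the error analysis.\<close>

lemma (in equi_energy) P_op_eq_kern:
  assumes f: "test f" and pY: "\<And>x. pY x > 0" and w: "w = (\<lambda>x. p x / pY x)"
  shows "P_op P \<epsilon> p pY (emp ys n) (\<lambda>x. ennreal (f x)) x = ennreal (kern (emp ys n) f x)"
proof -
  interpret \<theta>: prob_space "emp ys n" by (rule prob_space_emp)
  let ?a = "\<integral>z. metro (w x) (w z) \<partial>emp ys n" and ?b = "\<integral>z. metro (w x) (w z) * f z \<partial>emp ys n"
  have acc: "accept p pY x z = metro (w x) (w z)" for z
    using pY by (simp add: accept_eq_metro w)
  have b: "0 \<le> metro (w x) (w z)" "metro (w x) (w z) \<le> 1" for z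
    using metro_bounds w_nonneg by auto
  have ab: "0 \<le> ?b" "?b \<le> ?a" "?a \<le> 1"
    using metro_integral_bounds[OF prob_space_emp, of x ys n f] f by auto
  have P: "(\<integral>\<^sup>+y. ennreal (f y) \<partial>P x) = ennreal (\<integral>y. f y \<partial>P x)"
    using f by (intro nn_integral_eq_integral integrable_P) auto
  have "integrable (emp ys n) (\<lambda>z. metro (w x) (w z) * f z)"
    using f b by (intro \<theta>.integrable_const_bound[where B=1]) (auto simp: abs_mult mult_le_one)
  then have "(\<integral>\<^sup>+z. ennreal (metro (w x) (w z) * f z) \<partial>emp ys n) = ennreal ?b"
    using f b by (intro nn_integral_eq_integral) auto
  then have \<theta>: "(\<integral>\<^sup>+z. ennreal (metro (w x) (w z)) * ennreal (f z) \<partial>emp ys n) = ennreal ?b"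
    using f b by (simp add: ennreal_mult)
  \<comment> \<open>Subtraction in \<open>ennreal\<close> is truncated at 0;
    \<open>?a \<le> 1\<close> makes it agree with the real one.\<close>
  have "1 - ennreal ?a = ennreal (1 - ?a)"
    using ab by (subst ennreal_1[symmetric], subst ennreal_minus) auto
  then show ?thesis
    unfolding P_op_def K_op_def kern_def acc P \<theta>
    using ab f integral_P_bounds[OF f] \<epsilon>
    by (simp add: ennreal_mult ennreal_plus)
qed

text \<open>Change of measure: positivity of \<open>pY\<close> lets it cancel against the
  denominator of the density ratio.\<close>

lemma integral_dens_eq:
  fixes f p pY :: "'a \<Rightarrow> real"
  assumes "sets \<mu> = sets N" and [measurable]: "f \<in> borel_measurable N" "p \<in> borel_measurable N" "pY \<in> borel_measurable N"
    and "\<And>x. p x \<ge> 0" "\<And>x. pY x > 0"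
  shows "(\<integral>x. f x \<partial>dens \<mu> p) = (\<integral>x. p x / pY x * f x \<partial>dens \<mu> pY)"
proof -
  have [measurable_cong]: "sets \<mu> = sets N" by fact
  have "pY x * (p x / pY x * f x) = p x * f x" for x
    using assms(6)[of x] by simp
  then show ?thesis
    unfolding dens_def using assms(5,6)
    by (subst (1 2) integral_density) (auto simp: less_imp_le)
qed

lemma prob_space_dens:
  assumes "sets \<mu> = sets N" and [measurable]: "p \<in> borel_measurable N"
    and "(\<integral>\<^sup>+x. ennreal (p x) \<partial>\<mu>) = 1"
  shows "prob_space (dens \<mu> p)"
proof -
  have [measurable_cong]: "sets \<mu> = sets N" by fact
  show ?thesis
    unfolding dens_def using assms(3)
    by (intro prob_spaceI) (simp add: emeasure_density)
qed

text \<open>Invariance on sets says that \<open>\<pi> \<bind> P\<close> and \<pi> are the same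
  measure; integrating \<open>f\<close> against both gives the claim.\<close>

lemma integral_stationary:
  fixes f :: "'a \<Rightarrow> real"
  assumes "prob_space \<pi>" and sets: "sets \<pi> = sets N" and P: "P \<in> N \<rightarrow>\<^sub>M prob_algebra N"
    and stat: "\<And>A. A \<in> sets N \<Longrightarrow> (\<integral>\<^sup>+x. emeasure (P x) A \<partial>\<pi>) = emeasure \<pi> A"
    and f: "f \<in> borel_measurable N" "\<And>x. \<bar>f x\<bar> \<le> b"
  shows "(\<integral>x. (\<integral>y. f y \<partial>P x) \<partial>\<pi>) = (\<integral>x. f x \<partial>\<pi>)"
proof -
  interpret prob_space \<pi> by fact
  have P': "P \<in> \<pi> \<rightarrow>\<^sub>M subprob_algebra N"
    using measurable_prob_algebraD[OF P] sets by (simp cong: measurable_cong_sets)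
  have "\<pi> \<bind> P = \<pi>"
  proof (rule measure_eqI)
    show "sets (\<pi> \<bind> P) = sets \<pi>"
      using sets_bind[OF sets_kernel[OF P'] not_empty] sets by simp
    then show "emeasure (\<pi> \<bind> P) A = emeasure \<pi> A" if "A \<in> sets (\<pi> \<bind> P)" for A
      using that emeasure_bind[OF not_empty P', of A] stat sets by simp
  qed
  then have "(\<integral>x. f x \<partial>\<pi>) = (\<integral>x. f x \<partial>(\<pi> \<bind> P))" by simp
  also have "\<dots> = (\<integral>x. (\<integral>y. f y \<partial>P x) \<partial>\<pi>)"
    using f(2) by (intro integral_bind[OF f(1) _ P' finite_measure_axioms, where B=b and B'=1]) 
      (auto intro!: AE_I2 subprob_space.emeasure_space_le_1 subprob_space_kernel[OF P'])
  finally show ?thesis by simp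
qed

theorem theorem3:
  fixes \<mu> :: "'a::polish_space measure"
    and p pY :: "'a \<Rightarrow> real"
    and P :: "'a \<Rightarrow> 'a measure"
    and \<epsilon> :: real
    and M :: "'b measure"
    and X Y :: "nat \<Rightarrow> 'b \<Rightarrow> 'a"
    and x0 y0 :: 'a
  assumes sets_mu: "sets \<mu> = sets borel"
    and sf_mu: "sigma_finite_measure \<mu>"
    and p_meas: "p \<in> borel_measurable borel" and p_nonneg: "\<And>x. p x \<ge> 0"
    and p_prob: "(\<integral>\<^sup>+x. ennreal (p x) \<partial>\<mu>) = 1"
    and pY_meas: "pY \<in> borel_measurable borel" and pY_pos: "\<And>x. pY x > 0"
    and pY_prob: "(\<integral>\<^sup>+x. ennreal (pY x) \<partial>\<mu>) = 1"
    and w_bdd: "\<exists>B. \<forall>x. \<bar>p x / pY x\<bar> \<le> B"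
    and eps: "0 < \<epsilon>" "\<epsilon> < 1"
    and P_kernel: "P \<in> borel \<rightarrow>\<^sub>M prob_algebra borel"
    and P_stat: "\<forall>A\<in>sets borel. (\<integral>\<^sup>+x. emeasure (P x) A \<partial>(dens \<mu> p)) = emeasure (dens \<mu> p) A"
    and M_prob: "prob_space M"
    and X_meas: "\<And>n. X n \<in> M \<rightarrow>\<^sub>M borel"
    and Y_meas: "\<And>n. Y n \<in> M \<rightarrow>\<^sub>M borel"
    and X0: "\<forall>\<omega>\<in>space M. X 0 \<omega> = x0"
    and Y0: "\<forall>\<omega>\<in>space M. Y 0 \<omega> = y0"
    and Y_indep: "\<And>n h. h \<in> borel_measurable borel \<Longrightarrow> bounded (range h) \<Longrightarrow>
        AE \<omega> in M. real_cond_exp M (gen_sa M (X ` {..n} \<union> Y ` {..n})) (\<lambda>\<omega>. h (Y (Suc n) \<omega>)) \<omega>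
                  = real_cond_exp M (gen_sa M (Y ` {..n})) (\<lambda>\<omega>. h (Y (Suc n) \<omega>)) \<omega>"
    and X_trans: "\<And>n h. n \<ge> 1 \<Longrightarrow> h \<in> borel_measurable borel \<Longrightarrow>
        AE \<omega> in M. nn_cond_exp M (gen_sa M (X ` {..n} \<union> Y ` {..n})) (\<lambda>\<omega>. h (X (Suc n) \<omega>)) \<omega>
                  = P_op P \<epsilon> p pY (emp (\<lambda>i. Y i \<omega>) n) h (X n \<omega>)"
    and A1: "\<exists>C. \<forall>f. f \<in> borel_measurable borel \<longrightarrow> (\<forall>x. \<bar>f x\<bar> \<le> 1) \<longrightarrow>
        (\<forall>x>0. \<forall>n\<ge>1.
          prob_space.prob M {\<omega>\<in>space M. \<bar>(1 / sqrt n) * (\<Sum>j=1..n. f (Y j \<omega>) - (\<integral>z. f z \<partial>(dens \<mu> pY)))\<bar> > x}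
          \<le> (let s2 = (\<integral>z. (f z)\<^sup>2 \<partial>(dens \<mu> pY)) in
               if s2 = 0 then 0 else C * exp (- (x\<^sup>2 / (C * s2)))))"
    and A2_cont: "continuous_on UNIV (\<lambda>x. p x / pY x)"
    and A2_phi: "\<exists>K. \<forall>x. measure (dens \<mu> pY) {z. p z / pY z \<le> p x / pY x} \<le> K * (p x / pY x)\<^sup>2"
    and A3: "\<And>f::'a \<Rightarrow> real. continuous_on UNIV f \<Longrightarrow> (\<forall>x. integrable (P x) f) \<Longrightarrow>
        continuous_on UNIV (\<lambda>x. \<integral>y. f y \<partial>(P x))"
  shows "\<exists>C. \<forall>f::'a \<Rightarrow> real. continuous_on UNIV f \<longrightarrow> bounded (range f) \<longrightarrow>
           (\<forall>n\<ge>1. \<bar>prob_space.expectation M (\<lambda>\<omega>. f (X n \<omega>)) - (\<integral>x. f x \<partial>(dens \<mu> p))\<bar>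
                    \<le> C * (SUP x. \<bar>f x\<bar>) / sqrt n)"
proof -

  \<comment> \<open>Choice of constants and verification of the locale assumptions\<close>
  define \<beta> where "\<beta> = dens \<mu> pY"
  define w where "w = (\<lambda>x. p x / pY x)"
  obtain B0 where B0: "\<And>x. \<bar>p x / pY x\<bar> \<le> B0" using w_bdd by auto
  \<comment> \<open>The maximum with 1 keeps \<open>B\<close> positive and
    \<open>\<epsilon> / B\<close> below 1.\<close>
  define B where "B = max B0 1"
  obtain C0 where C0: "\<And>f x n. f \<in> borel_measurable borel \<Longrightarrow> (\<And>x. \<bar>f x\<bar> \<le> 1) \<Longrightarrow> x > 0 \<Longrightarrow> n \<ge> 1 \<Longrightarrow>
      prob_space.prob M {\<omega>\<in>space M. \<bar>(1 / sqrt n) * (\<Sum>j=1..n. f (Y j \<omega>) - (\<integral>z. f z \<partial>\<beta>))\<bar> > x}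
        \<le> (if (\<integral>z. (f z)\<^sup>2 \<partial>\<beta>) = 0 then 0 else C0 * exp (- (x\<^sup>2 / (C0 * (\<integral>z. (f z)\<^sup>2 \<partial>\<beta>)))))"
    using A1 unfolding Let_def \<beta>_def by blast
  \<comment> \<open>The given constants may be negative; raising them, here and for
    \<open>K\<close>, meets the sign conditions and preserves the bounds.\<close>
  define C where "C = max C0 1"
  obtain K0 where K0: "\<And>x. measure \<beta> {z. w z \<le> w x} \<le> K0 * (w x)\<^sup>2"
    using A2_phi unfolding \<beta>_def w_def by auto
  define K where "K = max K0 0"
  interpret M: prob_space M by (rule M_prob)
  have prob_\<beta>: "prob_space \<beta>" and prob_\<pi>: "prob_space (dens \<mu> p)"
    unfolding \<beta>_def using sets_mu pY_meas pY_prob p_meas p_prob by (auto intro: prob_space_dens)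
  have sets_\<beta>: "sets \<beta> = sets borel" and sets_\<pi>: "sets (dens \<mu> p) = sets borel"
    by (simp_all add: \<beta>_def dens_def sets_mu)
  have w_meas [measurable]: "w \<in> borel_measurable borel"
    using p_meas pY_meas unfolding w_def by measurable
  have w_nn: "0 \<le> w x" for x
    using p_nonneg pY_pos[of x] by (simp add: w_def less_imp_le)
  have \<pi>_eq: "(\<integral>x. f x \<partial>dens \<mu> p) = (\<integral>x. w x * f x \<partial>\<beta>)" if "f \<in> borel_measurable borel" for f :: "'a \<Rightarrow> real"
    unfolding \<beta>_def w_def by (rule integral_dens_eq) (use assms that in auto)
  interpret equi_energy M \<beta> Y w B C K X P \<epsilon>
  proof (intro equi_energy.intro empirical_metropolis.intro empirical_metropolis_axioms.intro equi_energy_axioms.intro)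
    show "w z \<le> B" for z
      using abs_le_D1[OF B0[of z]] by (simp add: w_def B_def)
    show "(\<integral>z. w z \<partial>\<beta>) = 1"
      using \<pi>_eq[of "\<lambda>_. 1"] prob_space.prob_space[OF prob_\<pi>] by simp
    show "measure \<beta> {z. w z \<le> w x} \<le> K * (w x)\<^sup>2" for x
      using K0[of x] mult_right_mono[of K0 K "(w x)\<^sup>2"] by (simp add: K_def)
    fix f :: "'a \<Rightarrow> real" and x :: real and n :: nat
    assume f: "f \<in> borel_measurable borel" "\<And>z. \<bar>f z\<bar> \<le> 1" and x: "x > 0" and n: "n \<ge> 1"
    let ?s = "\<integral>z. (f z)\<^sup>2 \<partial>\<beta>"
    have "(1 / sqrt n) * (\<Sum>j=1..n. f (Y j \<omega>) - (\<integral>z. f z \<partial>\<beta>)) = sqrt n * emp_dev \<beta> (\<lambda>i. Y i \<omega>) n f" for \<omega>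
    proof -
      have "1 / sqrt n = sqrt n / n" using n by (simp add: real_div_sqrt field_simps)
      then show ?thesis
        using n by (simp add: emp_dev_def integral_emp[OF n] sum_subtractf field_simps)
    qed
    then have "M.prob {\<omega>\<in>space M. \<bar>sqrt (real n) * emp_dev \<beta> (\<lambda>i. Y i \<omega>) n f\<bar> > x}
        \<le> (if ?s = 0 then 0 else C0 * exp (- (x\<^sup>2 / (C0 * ?s))))"
      using C0[OF f x n] by simp
    \<comment> \<open>Raising a positive constant enlarges the prefactor and slows the decay; for
      \<open>C0 \<le> 0\<close> the old bound is at most 0.\<close>
    also have "\<dots> \<le> (if ?s = 0 then 0 else C * exp (- (x\<^sup>2 / (C * ?s))))"
    proof (cases "?s = 0 \<or> C0 \<le> 0")
      case True
      have "C0 * exp (- (x\<^sup>2 / (C0 * ?s))) \<le> 0" if "C0 \<le> 0"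
        using that by (simp add: mult_le_0_iff)
      moreover have "0 \<le> C * exp (- (x\<^sup>2 / (C * ?s)))" by (simp add: C_def)
      ultimately show ?thesis using True by auto
    next
      case False
      have "0 \<le> ?s" by simp
      with False have s: "0 < ?s" "0 < C0" by (metis less_le, simp)
      have "C0 \<le> C" by (simp add: C_def)
      then have "x\<^sup>2 / (C * ?s) \<le> x\<^sup>2 / (C0 * ?s)"
        using s by (intro divide_left_mono mult_right_mono mult_pos_pos) auto
      then have "C0 * exp (- (x\<^sup>2 / (C0 * ?s))) \<le> C * exp (- (x\<^sup>2 / (C * ?s)))"
        using s \<open>C0 \<le> C\<close> by (intro mult_mono) auto
      then show ?thesis by simp
    qed
    finally show "M.prob {\<omega>\<in>space M. \<bar>sqrt (real n) * emp_dev \<beta> (\<lambda>i. Y i \<omega>) n f\<bar> > x}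
        \<le> (if ?s = 0 then 0 else C * exp (- (x\<^sup>2 / (C * ?s))))" .
  qed (use assms prob_\<beta> sets_\<beta> w_nn in \<open>auto simp: B_def C_def K_def\<close>)

  \<comment> \<open>Stationarity and the transition law in terms of \<open>target\<close> and
    \<open>kern\<close>\<close>
  have target_eq: "target f = (\<integral>x. f x \<partial>dens \<mu> p)" if "f \<in> borel_measurable borel" for f
    using \<pi>_eq[OF that] by (simp add: target_def)
  have stat: "target (\<lambda>x. \<integral>y. f y \<partial>P x) = target f" if "test f" for f
  proof -
    have [measurable]: "f \<in> borel_measurable borel" using that by simp
    have "(\<integral>x. (\<integral>y. f y \<partial>P x) \<partial>dens \<mu> p) = (\<integral>x. f x \<partial>dens \<mu> p)"
      by (rule integral_stationary[OF prob_\<pi> sets_\<pi> P_kernel, where b = 1]) (use P_stat that in auto)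
    then show ?thesis by (simp add: target_eq)
  qed
  have step: "M.expectation (\<lambda>\<omega>. f (X (Suc n) \<omega>)) = M.expectation (\<lambda>\<omega>. kern (emp (\<lambda>i. Y i \<omega>) n) f (X n \<omega>))"
    if n: "n \<ge> 1" and f: "test f" for n f
  proof -
    have [measurable]: "f \<in> borel_measurable borel" using f by simp
    let ?F = "gen_sa M (X ` {..n} \<union> Y ` {..n})"
    have sub: "subalgebra M ?F"
      by (rule subalgebra_gen_sa) (use X_meas Y_meas in auto)
    \<comment> \<open>Taking expectations removes the conditioning: first the tower property, then
      the transition law.\<close>
    have "(\<integral>\<^sup>+\<omega>. ennreal (f (X (Suc n) \<omega>)) \<partial>M)
        = (\<integral>\<^sup>+\<omega>. nn_cond_exp M ?F (\<lambda>\<omega>. ennreal (f (X (Suc n) \<omega>))) \<omega> \<partial>M)"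
      by (rule M.nn_integral_nn_cond_exp[OF sub, symmetric]) measurable
    also have "\<dots> = (\<integral>\<^sup>+\<omega>. ennreal (kern (emp (\<lambda>i. Y i \<omega>) n) f (X n \<omega>)) \<partial>M)"
      using X_trans[OF n, of "\<lambda>x. ennreal (f x)"]
      by (intro nn_integral_cong_AE) (simp add: P_op_eq_kern[OF f pY_pos w_def])
    finally show ?thesis
      using f kern_bounds(1)[OF f prob_space_emp] measurable_kern_emp[OF _ n, of f]
      by (subst (1 2) integral_eq_nn_integral) auto
  qed

  \<comment> \<open>Rescaling to bounded continuous functions\<close>
  obtain L where L: "0 \<le> L" "\<And>n f. n \<ge> 1 \<Longrightarrow> test f \<Longrightarrow> \<bar>M.expectation (\<lambda>\<omega>. f (X n \<omega>)) - target f\<bar> \<le> L / sqrt n"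
    using expectation_target_diff_le[OF stat step] by blast
  show ?thesis
  proof (intro exI[of _ "2 * L"] allI impI)
    fix f :: "'a \<Rightarrow> real" and n :: nat
    assume cont: "continuous_on UNIV f" and bdd: "bounded (range f)" and n: "1 \<le> n"
    have [measurable]: "f \<in> borel_measurable borel"
      using cont by (rule borel_measurable_continuous_onI)
    define F where "F = (SUP x. \<bar>f x\<bar>)"
    obtain a where "\<And>x. \<bar>f x\<bar> \<le> a"
      using bdd by (auto simp: bounded_iff)
    then have "bdd_above (range (\<lambda>x. \<bar>f x\<bar>))"
      by (intro bdd_aboveI2)
    then have F: "\<bar>f x\<bar> \<le> F" for x
      unfolding F_def by (intro cSUP_upper) auto
    show "\<bar>M.expectation (\<lambda>\<omega>. f (X n \<omega>)) - (\<integral>x. f x \<partial>dens \<mu> p)\<bar> \<le> 2 * L * (SUP x. \<bar>f x\<bar>) / sqrt n"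
      unfolding F_def[symmetric]
    proof (cases "F = 0")
      \<comment> \<open>The rescaling in the other case divides by \<open>2 * F\<close>, so the zero
        function is treated apart.\<close>
      case True
      with F have "f x = 0" for x by simp
      with True show "\<bar>M.expectation (\<lambda>\<omega>. f (X n \<omega>)) - (\<integral>x. f x \<partial>dens \<mu> p)\<bar> \<le> 2 * L * F / sqrt n"
        by simp
    next
      case False
      with F[of undefined] have F0: "0 < F" by linarith
      \<comment> \<open>This affine map sends [-F, F] to [0, 1]. In the error the shift cancels and
        the slope \<open>2 * F\<close> remains, which explains the constant
        \<open>2 * L\<close>.\<close>
      define g where "g x = (f x + F) / (2 * F)" for x
      have fg: "f x = 2 * F * g x - F" for x using F0 by (simp add: g_def)
      have "0 \<le> g x \<and> g x \<le> 1" for x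
        using F[of x] F0 by (auto simp: g_def abs_le_iff field_simps)
      moreover have [measurable]: "g \<in> borel_measurable borel" unfolding g_def[abs_def] by measurable
      ultimately have g: "test g" by simp
      have "integrable M (\<lambda>\<omega>. g (X n \<omega>))"
        using g by (intro M.integrable_const_bound[where B=1]) auto
      then have 1: "M.expectation (\<lambda>\<omega>. f (X n \<omega>)) = 2 * F * M.expectation (\<lambda>\<omega>. g (X n \<omega>)) - F"
        unfolding fg by (simp add: M.prob_space)
      interpret \<pi>: prob_space "dens \<mu> p" by (rule prob_\<pi>)
      have "integrable (dens \<mu> p) g"
        using g sets_\<pi> by (intro \<pi>.integrable_const_bound[where B=1]) (auto cong: measurable_cong_sets)
      then have 2: "(\<integral>x. f x \<partial>dens \<mu> p) = 2 * F * target g - F"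
        unfolding fg by (simp add: \<pi>.prob_space target_eq)
      have "\<bar>M.expectation (\<lambda>\<omega>. f (X n \<omega>)) - (\<integral>x. f x \<partial>dens \<mu> p)\<bar>
          = 2 * F * \<bar>M.expectation (\<lambda>\<omega>. g (X n \<omega>)) - target g\<bar>"
        unfolding 1 2 using F0 by (simp add: abs_mult flip: right_diff_distrib)
      also have "\<dots> \<le> 2 * F * (L / sqrt n)"
        using L(2)[OF n g] F0 by (intro mult_left_mono) auto
      finally show "\<bar>M.expectation (\<lambda>\<omega>. f (X n \<omega>)) - (\<integral>x. f x \<partial>dens \<mu> p)\<bar> \<le> 2 * L * F / sqrt n"
        by (simp add: mult_ac)
    qed
  qed
qed

end
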